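(* Let $n\in\mathbb N$, let $\Gamma=(\gamma_{ij})_{i,j=1}^n$ be a gain matrix and let $\mu=(\mu_1,\dots,\mu_n)$ be a vector of monotone aggregation functions $\mu_i\in\mathrm{MAF}_n$. Let $\Gamma_\mu:\mathbb R^n_+\to\mathbb R^n_+$, $\Gamma_\mu(s)_i=\mu_i(\gamma_{i1}(s_1),\dots,\gamma_{in}(s_n))$. Assume that one of the following holds: (i) $\Gamma\in(\mathcal K_\infty\cup\{0\})^{n\times n}$, $\Gamma_\mu$ is linear and the spectral radius of $\Gamma_\mu$ is less than one; (ii) $\Gamma\in(\mathcal K_\infty\cup\{0\})^{n\times n}$ is irreducible and $\Gamma_\mu\not\ge\mathrm{id}$; (iii) $\Gamma\in(\mathcal K_\infty\cup\{0\})^{n\times n}$, $\mu=\max$ (that is, $\mu_i(s)=\max_{j}s_j$ for every $i$) and $\Gamma_\mu\not\ge\mathrm{id}$; (iv) alternatively, $\Gamma_\mu$ is bounded, i.e. $\Gamma\in((\mathcal K\setminus\mathcal K_\infty)\cup\{0\})^{n\times n}$, and $\Gamma_\mu\not\ge\mathrm{id}$. Then there exists an $\Omega$-path $\sigma$ with respect to $\Gamma_\mu$.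
   Context: Notation: $\mathbb R_+=[0,\infty)$, $\mathbb R^n_+=(\mathbb R_+)^n$. For $v,w\in\mathbb R^n$: $v\ge w$ iff $v_i\ge w_i$ for all $i$; $v>w$ iff $v_i>w_i$ for all $i$. For $T:\mathbb R^n_+\to\mathbb R^n_+$, $T\not\ge\mathrm{id}$ means: for every $s\in\mathbb R^n_+$, $s\neq0$, the relation $T(s)\ge s$ fails (some component of $T(s)$ is strictly smaller than that of $s$). $\mathcal K$ is the set of continuous, strictly increasing $\gamma:\mathbb R_+\to\mathbb R_+$ with $\gamma(0)=0$; $\mathcal K_\infty$ is the set of unbounded $\gamma\in\mathcal K$. A monotone aggregation function $\mu\in\mathrm{MAF}_n$ is a continuous function $\mu:\mathbb R^n_+\to\mathbb R_+$ such that (M1) $\mu(s)\ge0$ for all $s$ and $\mu(s)>0$ if $s\ge0$, $s\ne0$; (M2) $x<y$ implies $\mu(x)<\mu(y)$; (M3) $\mu(x)\to\infty$ as $\|x\|\to\infty$. Standing conventions: $\gamma_{ii}\equiv0$ for all $i$. $\Gamma$ and $\mu$ are compatible: for each $i$ let $I_i=\{j:\gamma_{ij}\not\equiv0\}$; whenever $I_i\ne\emptyset$, the function obtained from $\mu_i$ by setting all arguments with index outside $I_i$ equal to $0$ is strictly increasing in the sense of (M2) in the remaining arguments. $\Gamma$ is irreducible if its adjacency matrix $A_\Gamma=(a_{ij})$, $a_{ij}=0$ if $\gamma_{ij}\equiv0$ and $a_{ij}=1$ otherwise, is irreducible, i.e. for every pair $(i,j)$ there is $k\ge1$ such that the $(i,j)$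 entry of $A_\Gamma^k$ is positive. An $\Omega$-path with respect to $\Gamma_\mu$ is a continuous path $\sigma=(\sigma_1,\dots,\sigma_n)\in\mathcal K_\infty^n$ such that (i) each $\sigma_i^{-1}$ is locally Lipschitz continuous on $(0,\infty)$; (ii) for every compact $K\subset(0,\infty)$ there are constants $0<c<C$ such that for all $i$ and all points $r\in K$ of differentiability of $\sigma_i^{-1}$, $c\le(\sigma_i^{-1})'(r)\le C$; (iii) $\Gamma_\mu(\sigma(r))<\sigma(r)$ for all $r>0$. *)

theory Defs
  imports "HOL-Analysis.Analysis"
begin

text \<open>
  Functions on \<open>[0,\<infinity>)\<close> or on the nonnegative orthant of \<open>real^'n\<close> are represented by total functions;
  only their values on \<open>{0..}\<close> are ever constrained. On \<open>real^'n\<close> the library relation \<open>\<le>\<close> is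
  the componentwise order, so \<open>{0..}\<close> is the nonnegative orthant. The library relation \<open><\<close> means
  \<open>\<le>\<close> and \<open>\<noteq>\<close>; strict inequality in every component is \<open>strictly_below\<close>.
\<close>

definition strictly_below :: "real^'n \<Rightarrow> real^'n \<Rightarrow> bool" where
  "strictly_below v w \<longleftrightarrow> (\<forall>i. v $ i < w $ i)"

definition not_ge_id :: "(real^'n \<Rightarrow> real^'n) \<Rightarrow> bool" where
  "not_ge_id T \<longleftrightarrow> (\<forall>s\<ge>0. s \<noteq> 0 \<longrightarrow> \<not> T s \<ge> s)"

definition class_K :: "(real \<Rightarrow> real) set" where
  "class_K = {g. continuous_on {0..} g \<and> strict_mono_on {0..} g \<and> g 0 = 0}"

definition class_K_inf :: "(real \<Rightarrow> real) set" where
  "class_K_inf = {g \<in> class_K. \<not> bounded (g ` {0..})}"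

definition zero_gain :: "(real \<Rightarrow> real) set" where
  "zero_gain = {g. \<forall>r\<ge>0. g r = 0}"

definition gain_matrix :: "('n \<Rightarrow> 'n \<Rightarrow> real \<Rightarrow> real) \<Rightarrow> bool" where
  "gain_matrix \<gamma> \<longleftrightarrow> (\<forall>i j. \<gamma> i j \<in> class_K \<union> zero_gain) \<and> (\<forall>i. \<gamma> i i \<in> zero_gain)"

definition MAF :: "(real^'n \<Rightarrow> real) set" where
  "MAF = {m. continuous_on {0..} m
     \<and> (\<forall>s\<ge>0. m s \<ge> 0) \<and> (\<forall>s\<ge>0. s \<noteq> 0 \<longrightarrow> m s > 0)
     \<and> (\<forall>x\<ge>0. \<forall>y\<ge>0. strictly_below x y \<longrightarrow> m x < m y)
     \<and> filterlim m at_top (inf at_infinity (principal {0..}))}"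

definition Gain_op ::
  "('n \<Rightarrow> 'n \<Rightarrow> real \<Rightarrow> real) \<Rightarrow> ('n \<Rightarrow> real^'n \<Rightarrow> real) \<Rightarrow> real^'n \<Rightarrow> real^'n" where
  "Gain_op \<gamma> \<mu> s = (\<chi> i. \<mu> i (\<chi> j. \<gamma> i j (s $ j)))"

definition compatible ::
  "('n \<Rightarrow> 'n \<Rightarrow> real \<Rightarrow> real) \<Rightarrow> ('n \<Rightarrow> real^'n \<Rightarrow> real) \<Rightarrow> bool" where
  "compatible \<gamma> \<mu> \<longleftrightarrow>
     (\<forall>i. let I = {j. \<gamma> i j \<notin> zero_gain} in
        I \<noteq> {} \<longrightarrow>
        (\<forall>x\<ge>0. \<forall>y\<ge>0. (\<forall>j\<in>I. x $ j < y $ j) \<longrightarrow>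
           \<mu> i (\<chi> j. if j \<in> I then x $ j else 0) < \<mu> i (\<chi> j. if j \<in> I then y $ j else 0)))"

definition adjacency :: "('n \<Rightarrow> 'n \<Rightarrow> real \<Rightarrow> real) \<Rightarrow> nat^'n^'n" where
  "adjacency \<gamma> = (\<chi> i j. if \<gamma> i j \<in> zero_gain then 0 else 1)"

text \<open>The library power \<open>A ^ k\<close> on \<open>'a^'n^'n\<close> is componentwise; this is the matrix power.\<close>

primrec mat_power :: "'a::semiring_1^'n^'n \<Rightarrow> nat \<Rightarrow> 'a^'n^'n" where
  "mat_power A 0 = mat 1"
| "mat_power A (Suc k) = A ** mat_power A k"

definition irreducible_gain :: "('n::finite \<Rightarrow> 'n \<Rightarrow> real \<Rightarrow> real) \<Rightarrow> bool" where
  "irreducible_gain \<gamma> \<longleftrightarrow> (\<forall>i j. \<exists>k\<ge>1. mat_power (adjacency \<gamma>) k $ i $ j > 0)"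

text \<open>The spectrum is taken over the complex numbers; it is finite and nonempty, so the supremum
  is a maximum.\<close>

definition complex_spectrum :: "real^'n^'n \<Rightarrow> complex set" where
  "complex_spectrum A = {z. \<exists>v\<noteq>0. map_matrix complex_of_real A *v v = z *s v}"

definition spectral_radius :: "real^'n^'n \<Rightarrow> real" where
  "spectral_radius A = (SUP z\<in>complex_spectrum A. cmod z)"

definition locally_lipschitz_on :: "real set \<Rightarrow> (real \<Rightarrow> real) \<Rightarrow> bool" where
  "locally_lipschitz_on X f \<longleftrightarrow> (\<forall>x\<in>X. \<exists>u>0. \<exists>L. L-lipschitz_on (cball x u \<inter> X) f)"

text \<open>The inverse of a function in \<open>class_K_inf\<close>, as a bijection of \<open>{0..}\<close>.\<close>

abbreviation K_inverse :: "(real \<Rightarrow> real) \<Rightarrow> real \<Rightarrow> real" where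
  "K_inverse g \<equiv> inv_into {0..} g"

definition Omega_path :: "(real^'n \<Rightarrow> real^'n) \<Rightarrow> (real \<Rightarrow> real^'n) \<Rightarrow> bool" where
  "Omega_path T \<sigma> \<longleftrightarrow>
     (\<forall>i. (\<lambda>r. \<sigma> r $ i) \<in> class_K_inf)
   \<and> (\<forall>i. locally_lipschitz_on {0<..} (K_inverse (\<lambda>r. \<sigma> r $ i)))
   \<and> (\<forall>K. compact K \<and> K \<subseteq> {0<..} \<longrightarrow>
        (\<exists>c C. 0 < c \<and> c < C \<and>
          (\<forall>i. \<forall>r\<in>K. K_inverse (\<lambda>r. \<sigma> r $ i) differentiable (at r) \<longrightarrow>
             c \<le> deriv (K_inverse (\<lambda>r. \<sigma> r $ i)) r \<and> deriv (K_inverse (\<lambda>r. \<sigma> r $ i)) r \<le> C)))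
   \<and> (\<forall>r>0. strictly_below (T (\<sigma> r)) (\<sigma> r))"

end

(*
  A path that interpolates linearly between the points of an increasing chain (w m), m an integer,
  with T (w (m + 1)) < w m is an Omega-path: on each segment T is at most T (w (m + 1)), and the
  segment lies above w m. Such a chain exists whenever T satisfies the small gain condition and each
  of its components is bounded below by an unbounded positive function of the sum of the coordinates.
  Indeed T can then be enlarged strictly without violating the condition; Brouwer's theorem on
  simplices yields decay points of the enlarged map T' of every size, a compactness argument yields
  a bi-infinite T'-orbit growing from 0 to infinity, and the strict gap between T and T' leaves room
  to make the orbit strictly monotone. In cases (ii) to (iv) T is first raised to a function of the
  sum of the coordinates that is small enough to preserve the condition. In case (i) the chain
  consists of multiples of a Perron-Frobenius eigenvector of a positive perturbation of T.
*)
theory Submission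
  imports Defs
begin

section \<open>Paths through a bi-infinite chain\<close>

text \<open>The lower bound by a function of the total makes \<open>T\<close> positive off 0 and
  proper: images of closed sets are closed, preimages of points are compact, and growth of the total
  forces growth of every component. A general gain operator has neither property, since zero gains
  may leave some components at 0 and bounded gains may leave them bounded. Two maps are needed
  because an orbit of a single map is only weakly increasing and satisfies its defining equation
  without slack. The delicate point is to raise \<open>T\<close> to a function \<phi> of the total:
  this couples every component to all others and may destroy the small gain condition. Each case
  refutes \<open>s \<le> max (T s) (\<phi> (total s))\<close> for nonzero \<open>s\<close> in its
  own way. For bounded \<open>T\<close>, the excess of \<open>s\<close> over \<open>T s\<close> is
  too large to consist of components below \<phi>. For irreducible gains, iterating
  \<open>s \<mapsto> max s (T s)\<close> turns \<open>s\<close> into some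
  \<open>u \<le> T u\<close>. For the maximum, each component above \<phi> is supported by a single
  other component, and a pigeonhole argument on thresholds isolates a set of large components that
  support each other.\<close>

lemma has_real_derivative_between:
  fixes h :: "real \<Rightarrow> real"
  assumes "(h has_real_derivative D) (at r)" and "u < r" "r < v"
    and bound: "\<And>x y. u \<le> x \<Longrightarrow> x \<le> y \<Longrightarrow> y \<le> v \<Longrightarrow> c * (y - x) \<le> h y - h x \<and> h y - h x \<le> C * (y - x)"
  shows "c \<le> D \<and> D \<le> C"
proof -
  have lim: "((\<lambda>y. (h y - h r) / (y - r)) \<longlongrightarrow> D) (at r)"
    using assms(1) by (simp add: has_field_derivative_iff)
  have q: "c \<le> (h y - h r) / (y - r) \<and> (h y - h r) / (y - r) \<le> C" if "u < y" "y < v" "y \<noteq> r" for y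
  proof (cases "r < y")
    case True
    then show ?thesis using bound[of r y] that assms by (simp add: divide_simps)
  next
    case False
    then have "y < r" using that by simp
    then show ?thesis using bound[of y r] that assms by (simp add: divide_simps algebra_simps)
  qed
  have ev: "eventually (\<lambda>y. u < y \<and> y < v \<and> y \<noteq> r) (at r)"
    using eventually_at_in_open[of "{u<..<v}" r] assms(2,3) by simp
  have "c \<le> D"
    by (rule tendsto_lowerbound[OF lim eventually_mono[OF ev]]) (use q in auto)
  moreover have "D \<le> C"
    by (rule tendsto_upperbound[OF lim eventually_mono[OF ev]]) (use q in auto)
  ultimately show ?thesis by blast
qed

text \<open>These conditions suffice for one component of an Omega-path. Slopes may degenerate at 0
  and at infinity, so they are controlled only between positive bounds; \<open>small\<close>
  supplies continuity at 0 and \<open>large\<close> unboundedness.\<close>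

locale bilipschitz_path =
  fixes f :: "real \<Rightarrow> real"
  assumes zero: "f 0 = 0"
    and positive: "0 < x \<Longrightarrow> 0 < f x"
    and bilipschitz: "0 < p \<Longrightarrow> p < q \<Longrightarrow> \<exists>c>0. \<exists>C. \<forall>x y. p \<le> x \<and> x \<le> y \<and> y \<le> q \<longrightarrow>
          c * (y - x) \<le> f y - f x \<and> f y - f x \<le> C * (y - x)"
    and small: "0 < e \<Longrightarrow> \<exists>x>0. f x < e"
    and large: "\<exists>x>0. f x > B"
begin

lemma strict_mono_pos: "0 < x \<Longrightarrow> x < y \<Longrightarrow> f x < f y"
  using bilipschitz[of x y] by (smt (verit) mult_pos_pos)

lemma strict_mono: "strict_mono_on {0..} f"
  by (rule strict_mono_onI) (metis atLeast_iff less_eq_real_def strict_mono_pos positive zero)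

lemma mono: "0 \<le> x \<Longrightarrow> x \<le> y \<Longrightarrow> f x \<le> f y"
  using strict_mono by (metis atLeast_iff dual_order.trans less_eq_real_def strict_mono_on_def)

lemma continuous: "continuous_on {0..} f"
proof -
  have "continuous (at x within {0..}) f" if "0 \<le> x" for x
  proof (cases "x = 0")
    case True
    have "\<exists>d>0. \<forall>y\<ge>0. \<bar>y\<bar> < d \<longrightarrow> \<bar>f y\<bar> < e" if "0 < e" for e
    proof -
      obtain d where d: "d > 0" "f d < e" using small \<open>0 < e\<close> by blast
      have "\<bar>f y\<bar> < e" if "y \<ge> 0" "\<bar>y\<bar> < d" for y
        using mono[of y d] mono[of 0 y] zero that d by auto
      with d show ?thesis by blast
    qed
    with True zero show ?thesis by (force simp: continuous_within_eps_delta dist_real_def)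
  next
    case False
    with that have x: "0 < x" by simp
    obtain c C where b: "\<And>u v. x/2 \<le> u \<Longrightarrow> u \<le> v \<Longrightarrow> v \<le> 2*x \<Longrightarrow>
          c * (v - u) \<le> f v - f u \<and> f v - f u \<le> C * (v - u)" and "c > 0"
      using bilipschitz[of "x/2" "2*x"] x by auto
    have "\<bar>f v - f u\<bar> \<le> \<bar>C\<bar> * \<bar>v - u\<bar>" if "u \<in> {x/2..2*x}" "v \<in> {x/2..2*x}" for u v
    proof -
      have *: "\<bar>f v - f u\<bar> \<le> \<bar>C\<bar> * \<bar>v - u\<bar>" if "u \<in> {x/2..2*x}" "v \<in> {x/2..2*x}" "u \<le> v" for u v
      proof -
        have "f u \<le> f v" using mono[of u v] that x by auto
        moreover have "f v - f u \<le> \<bar>C\<bar> * (v - u)"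
          using b[of u v] that mult_right_mono[of C "\<bar>C\<bar>" "v - u"] by (simp add: abs_ge_self order_trans)
        ultimately show ?thesis using that by simp
      qed
      show ?thesis using *[of u v] *[of v u] that by (cases "u \<le> v") (auto simp: abs_minus_commute)
    qed
    then have "\<bar>C\<bar>-lipschitz_on {x/2..2*x} f"
      by (auto simp: lipschitz_on_def dist_real_def abs_minus_commute)
    then have "continuous_on {x/2..2*x} f" by (rule lipschitz_on_continuous_on)
    moreover have "x \<in> interior {x/2..2*x}" using x by simp
    ultimately have "isCont f x" by (rule continuous_on_interior)
    then show ?thesis by (rule continuous_at_imp_continuous_at_within)
  qed
  then show ?thesis by (simp add: continuous_on_eq_continuous_within)
qed

lemma in_class_K_inf: "f \<in> class_K_inf"
proof -
  have "\<not> bounded (f ` {0..})"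
  proof
    assume "bounded (f ` {0..})"
    then obtain B where "\<And>x. 0 \<le> x \<Longrightarrow> \<bar>f x\<bar> \<le> B" by (auto simp: bounded_iff)
    with large[of B] show False by (smt (verit))
  qed
  then show ?thesis by (simp add: class_K_inf_def class_K_def continuous strict_mono zero)
qed

text \<open>Inversion turns slope bounds \<open>c\<close>, \<open>C\<close> into \<open>1/C\<close>,
  \<open>1/c\<close>. The points \<open>p\<close> and \<open>q\<close> are chosen so that
  \<open>f\<close> maps their interval over that from \<open>u\<close> to \<open>v\<close>, and the
  intermediate value theorem provides the preimages.\<close>

lemma inverse_bilipschitz:
  assumes "0 < u" "u < v"
  obtains c C where "0 < c" and "\<And>x y. u \<le> x \<Longrightarrow> x \<le> y \<Longrightarrow> y \<le> v \<Longrightarrow>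
    c * (y - x) \<le> K_inverse f y - K_inverse f x \<and> K_inverse f y - K_inverse f x \<le> C * (y - x)"
proof -
  obtain p q where p: "0 < p" "f p < u" and q: "0 < q" "v < f q"
    using small large assms by meson
  have pq: "p < q"
    using mono[of q p] p q assms by (smt (verit))
  have cont: "continuous_on {p..q} f"
    by (rule continuous_on_subset[OF continuous]) (use p in auto)
  have h: "K_inverse f (f x) = x" if "0 \<le> x" for x
    using that strict_mono by (auto intro!: inv_into_f_f strict_mono_on_imp_inj_on)
  obtain c C where c: "0 < c" and b: "\<And>x y. p \<le> x \<Longrightarrow> x \<le> y \<Longrightarrow> y \<le> q \<Longrightarrow>
      c * (y - x) \<le> f y - f x \<and> f y - f x \<le> C * (y - x)"
    using bilipschitz[OF p(1) pq] by auto
  have C: "0 < C"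
    using b[of p q] pq c by (smt (verit) mult_pos_pos mult_nonpos_nonneg)
  have ex: "\<exists>x\<in>{p..q}. f x = t" if "u \<le> t" "t \<le> v" for t
    using IVT'[of f p t q] that p q pq cont by auto
  show thesis
  proof (rule that[of "1/C" "1/c"])
    fix x y assume xy: "u \<le> x" "x \<le> y" "y \<le> v"
    obtain x' y' where x': "x' \<in> {p..q}" "f x' = x" and y': "y' \<in> {p..q}" "f y' = y"
      using ex[of x] ex[of y] xy by auto
    have "x' \<le> y'" using strict_mono_pos[of y' x'] x' y' xy p by force
    then have "c * (y' - x') \<le> y - x \<and> y - x \<le> C * (y' - x')"
      using b[of x' y'] x' y' by auto
    moreover have "K_inverse f x = x'" "K_inverse f y = y'" using h x' y' p by auto
    ultimately show "1/C * (y - x) \<le> K_inverse f y - K_inverse f x \<and> K_inverse f y - K_inverse f x \<le> 1/c * (y - x)"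
      using c C by (auto simp: field_simps)
  qed (use C in auto)
qed

lemma locally_lipschitz_inverse: "locally_lipschitz_on {0<..} (K_inverse f)"
  unfolding locally_lipschitz_on_def
proof
  fix r :: real assume "r \<in> {0<..}"
  then have r: "0 < r" by simp
  then obtain c C where c: "0 < c" and b: "\<And>x y. r/2 \<le> x \<Longrightarrow> x \<le> y \<Longrightarrow> y \<le> 2 * r \<Longrightarrow>
    c * (y - x) \<le> K_inverse f y - K_inverse f x \<and> K_inverse f y - K_inverse f x \<le> C * (y - x)"
    using inverse_bilipschitz[of "r/2" "2*r"] by auto
  have C: "0 \<le> C"
  proof -
    have "2 * r - r = r" by simp
    with b[of r "2*r"] r have "c * r \<le> K_inverse f (2*r) - K_inverse f r"
      "K_inverse f (2*r) - K_inverse f r \<le> C * r"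
      by simp_all
    then have "c * r \<le> C * r" by (rule order_trans)
    then have "c \<le> C" using r by (rule mult_right_le_imp_le)
    then show ?thesis using c by simp
  qed
  have *: "\<bar>K_inverse f y - K_inverse f x\<bar> \<le> C * \<bar>y - x\<bar>"
    if "x \<in> {r/2..2*r}" "y \<in> {r/2..2*r}" for x y
  proof -
    have "\<bar>K_inverse f y - K_inverse f x\<bar> \<le> C * \<bar>y - x\<bar>"
      if "x \<in> {r/2..2*r}" "y \<in> {r/2..2*r}" "x \<le> y" for x y
    proof -
      have "0 \<le> c * (y - x)" using that c by simp
      moreover have "\<bar>y - x\<bar> = y - x" using that by simp
      moreover have "c * (y - x) \<le> K_inverse f y - K_inverse f x"
        "K_inverse f y - K_inverse f x \<le> C * (y - x)"
        using b[of x y] that by simp_all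
      ultimately show ?thesis by (simp only:)
    qed
    from this[of x y] this[of y x] that show ?thesis
      by (cases "x \<le> y") (auto simp: abs_minus_commute)
  qed
  have "C-lipschitz_on {r/2..2*r} (K_inverse f)"
    unfolding lipschitz_on_def dist_real_def
    using C * by (metis abs_minus_commute)
  moreover have "cball r (r/2) \<inter> {0<..} \<subseteq> {r/2..2*r}"
  proof
    fix x assume "x \<in> cball r (r/2) \<inter> {0<..}"
    then have "\<bar>r - x\<bar> \<le> r/2" by (simp add: dist_real_def)
    then have "r - x \<le> r/2" "- (r - x) \<le> r/2" by (rule abs_le_D1, rule abs_le_D2)
    then show "x \<in> {r/2..2*r}" using r by simp
  qed
  ultimately have "C-lipschitz_on (cball r (r/2) \<inter> {0<..}) (K_inverse f)"
    by (rule lipschitz_on_subset)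
  then show "\<exists>u>0. \<exists>L. L-lipschitz_on (cball r u \<inter> {0<..}) (K_inverse f)"
    using r half_gt_zero by blast
qed

lemma deriv_inverse_bounds:
  assumes "compact K" "K \<subseteq> {0<..}"
  shows "\<exists>c>0. \<exists>C. \<forall>r\<in>K. K_inverse f differentiable (at r) \<longrightarrow>
           c \<le> deriv (K_inverse f) r \<and> deriv (K_inverse f) r \<le> C"
proof (cases "K = {}")
  case False
  obtain a where a: "a \<in> K" "\<And>x. x \<in> K \<Longrightarrow> a \<le> x"
    using compact_attains_inf[OF assms(1) False] by blast
  obtain b where b: "b \<in> K" "\<And>x. x \<in> K \<Longrightarrow> x \<le> b"
    using compact_attains_sup[OF assms(1) False] by blast
  have "0 < a" "a \<le> b" using a b assms by auto
  obtain c C where c: "0 < c" and bnd: "\<And>x y. a/2 \<le> x \<Longrightarrow> x \<le> y \<Longrightarrow> y \<le> b + 1 \<Longrightarrow>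
    c * (y - x) \<le> K_inverse f y - K_inverse f x \<and> K_inverse f y - K_inverse f x \<le> C * (y - x)"
    using inverse_bilipschitz[of "a/2" "b + 1"] \<open>0 < a\<close> \<open>a \<le> b\<close> by auto
  have "c \<le> deriv (K_inverse f) r \<and> deriv (K_inverse f) r \<le> C"
    if "r \<in> K" "K_inverse f differentiable (at r)" for r
  proof -
    have "(K_inverse f has_real_derivative deriv (K_inverse f) r) (at r)"
      using that(2) DERIV_deriv_iff_real_differentiable by blast
    moreover have "a/2 < r" "r < b + 1" using a(2) b(2) \<open>0 < a\<close> that(1) by force+
    ultimately show ?thesis by (rule has_real_derivative_between) (use bnd in auto)
  qed
  with c show ?thesis by blast
qed (auto intro: exI[of _ 1])

end

section \<open>Piecewise linear interpolation at dyadic nodes\<close>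

text \<open>The nodes are the powers \<open>2 powi m\<close>, with value \<open>a m\<close>: they
  are indexed by all integers, accumulate at 0 and exhaust the positive half-line, and the floor of
  the binary logarithm finds the segment of \<open>r\<close>.\<close>

definition interpolate :: "(int \<Rightarrow> real) \<Rightarrow> real \<Rightarrow> real" where
  "interpolate a r = (if r \<le> 0 then 0 else
     a \<lfloor>log 2 r\<rfloor> + (r / 2 powi \<lfloor>log 2 r\<rfloor> - 1) * (a (\<lfloor>log 2 r\<rfloor> + 1) - a \<lfloor>log 2 r\<rfloor>))"

lemma dyadic_interval:
  fixes r :: real
  assumes "0 < r"
  shows "2 powi \<lfloor>log 2 r\<rfloor> \<le> r" "r < 2 powi (\<lfloor>log 2 r\<rfloor> + 1)"
proof -
  have "2 powr (real_of_int \<lfloor>log 2 r\<rfloor>) \<le> 2 powr (log 2 r)" "2 powr (log 2 r) < 2 powr (real_of_int (\<lfloor>log 2 r\<rfloor> + 1))"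
    by (auto simp: of_int_floor_le)
  then show "2 powi \<lfloor>log 2 r\<rfloor> \<le> r" "r < 2 powi (\<lfloor>log 2 r\<rfloor> + 1)"
    using assms by (auto simp del: of_int_add simp: powr_real_of_int')
qed

lemma floor_log_eq:
  fixes r :: real
  assumes "2 powi m \<le> r" "r < 2 powi (m + 1)"
  shows "\<lfloor>log 2 r\<rfloor> = m"
proof -
  have r: "0 < r" using assms(1) zero_less_power_int[of "2::real" m] by linarith
  have "(2::real) powi m < 2 powi (\<lfloor>log 2 r\<rfloor> + 1)" "(2::real) powi \<lfloor>log 2 r\<rfloor> < 2 powi (m + 1)"
    using assms dyadic_interval[OF r] by linarith+
  then have "m < \<lfloor>log 2 r\<rfloor> + 1" "\<lfloor>log 2 r\<rfloor> < m + 1"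
    using power_int_increasing[of _ _ "2::real"] by (meson not_le one_le_numeral)+
  then show ?thesis by linarith
qed

text \<open>The interval is closed on the right, where the floor already selects the next segment;
  neighbouring segments thus share their node and can be glued.\<close>

lemma interpolate_eq:
  assumes "2 powi m \<le> r" "r \<le> 2 powi (m + 1)"
  shows "interpolate a r = a m + (r / 2 powi m - 1) * (a (m + 1) - a m)"
proof (cases "r = 2 powi (m + 1)")
  case True
  have "r < 2 powi (m + 1 + 1)"
    using True by (simp add: power_int_add)
  then have "\<lfloor>log 2 r\<rfloor> = m + 1" using floor_log_eq[of "m + 1" r] True by simp
  moreover have "(0::real) < 2 powi m" by simp
  ultimately show ?thesis using True by (simp add: interpolate_def power_int_add not_le[symmetric])
next
  case False
  then have "\<lfloor>log 2 r\<rfloor> = m" using floor_log_eq assms by simp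
  moreover have "0 < r" using assms(1) zero_less_power_int[of "2::real" m] by linarith
  ultimately show ?thesis by (simp add: interpolate_def)
qed

lemma bilipschitz_glue:
  fixes f :: "real \<Rightarrow> real"
  assumes 1: "\<And>x y. p \<le> x \<Longrightarrow> x \<le> y \<Longrightarrow> y \<le> q \<Longrightarrow> c1 * (y - x) \<le> f y - f x \<and> f y - f x \<le> C1 * (y - x)"
    and 2: "\<And>x y. q \<le> x \<Longrightarrow> x \<le> y \<Longrightarrow> y \<le> r \<Longrightarrow> c2 * (y - x) \<le> f y - f x \<and> f y - f x \<le> C2 * (y - x)"
    and xy: "p \<le> x" "x \<le> y" "y \<le> r"
  shows "min c1 c2 * (y - x) \<le> f y - f x \<and> f y - f x \<le> max C1 C2 * (y - x)"
proof -
  have w: "min c1 c2 * d \<le> c1 * d" "min c1 c2 * d \<le> c2 * d" "C1 * d \<le> max C1 C2 * d" "C2 * d \<le> max C1 C2 * d"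
    if "0 \<le> d" for d :: real
    using that by (auto intro: mult_right_mono)
  consider "y \<le> q" | "q \<le> x" | "x \<le> q" "q \<le> y" by linarith
  then show ?thesis
  proof cases
    case 1 then show ?thesis using assms(1)[of x y] xy w[of "y - x"] by force
  next
    case 2 then show ?thesis using assms(2)[of x y] xy w[of "y - x"] by force
  next
    case 3
    have "min c1 c2 * (y - x) = min c1 c2 * (y - q) + min c1 c2 * (q - x)"
      "max C1 C2 * (y - x) = max C1 C2 * (y - q) + max C1 C2 * (q - x)"
      by (simp_all add: algebra_simps)
    then show ?thesis using assms(1)[of x q] assms(2)[of q y] 3 xy w[of "q - x"] w[of "y - q"] by force
  qed
qed

text \<open>Between two nodes there are finitely many segments, each of positive slope, so the least
  slope is positive. The induction adds one segment at a time.\<close>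

lemma interpolate_bilipschitz:
  assumes "\<And>m. a m < a (m + 1)"
  shows "\<exists>c>0. \<exists>C. \<forall>x y. 2 powi m \<le> x \<and> x \<le> y \<and> y \<le> 2 powi (m + int k) \<longrightarrow>
    c * (y - x) \<le> interpolate a y - interpolate a x \<and> interpolate a y - interpolate a x \<le> C * (y - x)"
proof (induction k)
  case 0
  have "x = y" if "2 powi m \<le> x" "x \<le> y" "y \<le> 2 powi (m + int 0)" for x y :: real
    using that by simp
  then show ?case
    by (intro exI[of _ 1] conjI allI impI) (metis diff_self mult_zero_right order_refl zero_less_one)+
next
  case (Suc k)
  then obtain c C where c: "0 < c" and ih: "\<And>x y. 2 powi m \<le> x \<Longrightarrow> x \<le> y \<Longrightarrow> y \<le> 2 powi (m + int k) \<Longrightarrow>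
    c * (y - x) \<le> interpolate a y - interpolate a x \<and> interpolate a y - interpolate a x \<le> C * (y - x)"
    by auto
  define d where "d = (a (m + int k + 1) - a (m + int k)) / 2 powi (m + int k)"
  have d: "0 < d" using assms[of "m + int k"] by (simp add: d_def)
  have step: "interpolate a y - interpolate a x = d * (y - x)"
    if "2 powi (m + int k) \<le> x" "x \<le> y" "y \<le> 2 powi (m + int k + 1)" for x y
    using that by (simp add: interpolate_eq[of "m + int k"] d_def field_simps)
  have "min c d * (y - x) \<le> interpolate a y - interpolate a x \<and>
      interpolate a y - interpolate a x \<le> max C d * (y - x)"
    if "2 powi m \<le> x" "x \<le> y" "y \<le> 2 powi (m + int (Suc k))" for x y
    by (rule bilipschitz_glue[of "2 powi m" "2 powi (m + int k)" c _ C "2 powi (m + int k + 1)"])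
      (use ih step that in \<open>auto simp: add_ac\<close>)
  then show ?case using c d by (intro exI[of _ "min c d"] conjI exI[of _ "max C d"]) auto
qed

lemma interpolate_node [simp]: "interpolate a (2 powi m) = a m"
  using interpolate_eq[of m "2 powi m" a] by (simp add: power_int_add)

lemma bilipschitz_path_interpolate:
  assumes inc: "\<And>m. a m < a (m + 1)" and pos: "\<And>m. 0 < a m"
    and small: "\<And>e. 0 < e \<Longrightarrow> \<exists>m. a m < e" and large: "\<And>B. \<exists>m. B < a m"
  shows "bilipschitz_path (interpolate a)"
proof
  show "interpolate a 0 = 0" by (simp add: interpolate_def)
  show "\<exists>x>0. interpolate a x < e" if "0 < e" for e
    using small[OF that] by (metis interpolate_node zero_less_power_int zero_less_numeral)
  show "\<exists>x>0. interpolate a x > B" for B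
    using large by (metis interpolate_node zero_less_power_int zero_less_numeral)
  show "0 < interpolate a x" if "0 < x" for x
  proof -
    have "0 \<le> x / 2 powi \<lfloor>log 2 x\<rfloor> - 1" using dyadic_interval(1)[OF that] by simp
    then have "0 \<le> (x / 2 powi \<lfloor>log 2 x\<rfloor> - 1) * (a (\<lfloor>log 2 x\<rfloor> + 1) - a \<lfloor>log 2 x\<rfloor>)"
      using inc by (simp add: less_imp_le)
    then show ?thesis using pos[of "\<lfloor>log 2 x\<rfloor>"] that by (simp add: interpolate_def)
  qed
  show "\<exists>c>0. \<exists>C. \<forall>x y. p \<le> x \<and> x \<le> y \<and> y \<le> q \<longrightarrow>
      c * (y - x) \<le> interpolate a y - interpolate a x \<and> interpolate a y - interpolate a x \<le> C * (y - x)"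
    if pq: "0 < p" "p < q" for p q
  proof -
    define k where "k = nat (\<lfloor>log 2 q\<rfloor> + 1 - \<lfloor>log 2 p\<rfloor>)"
    have "\<lfloor>log 2 p\<rfloor> \<le> \<lfloor>log 2 q\<rfloor>" using pq by (intro floor_mono) simp
    then have k: "\<lfloor>log 2 q\<rfloor> + 1 = \<lfloor>log 2 p\<rfloor> + int k" by (simp add: k_def)
    have "2 powi \<lfloor>log 2 p\<rfloor> \<le> p" "q \<le> 2 powi (\<lfloor>log 2 p\<rfloor> + int k)"
      using dyadic_interval[of p] dyadic_interval[of q] pq unfolding k[symmetric] by auto
    then show ?thesis
      using interpolate_bilipschitz[of a "\<lfloor>log 2 p\<rfloor>" k, OF inc] by (meson order_trans)
  qed
qed

definition decay_chain :: "(real^'n \<Rightarrow> real^'n) \<Rightarrow> (int \<Rightarrow> real^'n) \<Rightarrow> bool" where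
  "decay_chain T w \<longleftrightarrow> (\<forall>m. strictly_below 0 (w m) \<and> strictly_below (w m) (w (m + 1))
       \<and> strictly_below (T (w (m + 1))) (w m))
     \<and> (\<forall>i. \<forall>e>0. \<exists>m. w m $ i < e) \<and> (\<forall>i B. \<exists>m. B < w m $ i)"

lemma decay_chain_imp_Omega_path:
  fixes T :: "real^'n::finite \<Rightarrow> real^'n"
  assumes mono: "\<And>x y. 0 \<le> x \<Longrightarrow> x \<le> y \<Longrightarrow> T x \<le> T y" and chain: "decay_chain T w"
  shows "\<exists>\<sigma>. Omega_path T \<sigma>"
proof -
  have w: "0 < w m $ i" "w m $ i < w (m + 1) $ i" "T (w (m + 1)) $ i < w m $ i" for m i
    using chain by (auto simp: decay_chain_def strictly_below_def)
  define f where "f i = interpolate (\<lambda>m. w m $ i)" for i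
  interpret f: bilipschitz_path "f i" for i
    unfolding f_def
    by (rule bilipschitz_path_interpolate) (use w chain in \<open>auto simp: decay_chain_def\<close>)
  define \<sigma> where "\<sigma> r = (\<chi> i. f i r)" for r
  have \<sigma>: "(\<lambda>r. \<sigma> r $ i) = f i" for i by (simp add: \<sigma>_def)
  have "\<exists>c C. 0 < c \<and> c < C \<and> (\<forall>i. \<forall>r\<in>K. K_inverse (f i) differentiable (at r) \<longrightarrow>
             c \<le> deriv (K_inverse (f i)) r \<and> deriv (K_inverse (f i)) r \<le> C)"
    if K: "compact K" "K \<subseteq> {0<..}" for K
  proof -
    obtain c C where c: "\<And>i. 0 < c i" and b: "\<And>i r. r \<in> K \<Longrightarrow> K_inverse (f i) differentiable (at r) \<Longrightarrow>
           c i \<le> deriv (K_inverse (f i)) r \<and> deriv (K_inverse (f i)) r \<le> C i"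
      using f.deriv_inverse_bounds[OF K] by metis
    define c' where "c' = Min (range c)"
    \<comment> \<open>The entry \<open>c' + 1\<close> enforces the strict inequality between the two
      constants that an Omega-path demands.\<close>
    define C' where "C' = max (c' + 1) (Max (range C))"
    have "0 < c'" using c by (simp add: c'_def)
    moreover have "c' \<le> c i" "C i \<le> C'" for i
      by (auto simp: c'_def C'_def le_max_iff_disj)
    moreover have "c' < C'" by (simp add: C'_def)
    ultimately show ?thesis using b by (meson order_trans)
  qed
  moreover have "strictly_below (T (\<sigma> r)) (\<sigma> r)" if r: "0 < r" for r
  proof -
    define m where "m = \<lfloor>log 2 r\<rfloor>"
    have bounds: "w m $ i \<le> \<sigma> r $ i" "\<sigma> r $ i \<le> w (m + 1) $ i" for i
      using f.mono[of "2 powi m" r i] f.mono[of r "2 powi (m + 1)" i] dyadic_interval[OF r] r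
      by (simp_all add: \<sigma>_def f_def m_def)
    have "0 \<le> \<sigma> r" using bounds(1) w(1)[of m] by (force simp: less_eq_vec_def intro: order_trans[of 0 "w m $ _" "\<sigma> r $ _"] less_imp_le)
    then have "T (\<sigma> r) \<le> T (w (m + 1))" using bounds(2) by (intro mono) (simp_all add: less_eq_vec_def)
    then have "T (\<sigma> r) $ i < \<sigma> r $ i" for i
      using w(3)[of m i] bounds(1)[of i] by (smt (verit) less_eq_vec_def)
    then show ?thesis by (simp add: strictly_below_def)
  qed
  ultimately have "Omega_path T \<sigma>"
    unfolding Omega_path_def \<sigma>
    using f.in_class_K_inf f.locally_lipschitz_inverse by blast
  then show ?thesis by blast
qed

section \<open>Decay chains of maps with a lower bound\<close>

abbreviation total :: "real^'n::finite \<Rightarrow> real" where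
  "total s \<equiv> \<Sum>i\<in>UNIV. s $ i"

lemma total_nonneg: "0 \<le> s \<Longrightarrow> 0 \<le> total s"
  by (simp add: less_eq_vec_def sum_nonneg)

lemma component_le_total: "0 \<le> s \<Longrightarrow> s $ i \<le> total s"
  by (rule member_le_sum) (auto simp: less_eq_vec_def)

lemma total_pos: "0 \<le> s \<Longrightarrow> s \<noteq> 0 \<Longrightarrow> 0 < total s"
  using component_le_total[of s] by (auto simp: vec_eq_iff less_eq_vec_def) (metis order.not_eq_order_implies_strict order.strict_trans2)

lemma norm_le_total: "0 \<le> s \<Longrightarrow> norm s \<le> total s"
  using norm_le_l1_cart[of s] by (simp add: less_eq_vec_def)

lemma compact_total_between:
  assumes "closed C" "C \<subseteq> {0..}"
  shows "compact (C \<inter> {s :: real^'n::finite. a \<le> total s \<and> total s \<le> b})"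
proof -
  have "closed {s :: real^'n. a \<le> total s}" "closed {s :: real^'n. total s \<le> b}"
    by (intro closed_Collect_le continuous_intros)+
  then have "closed (C \<inter> {s. a \<le> total s \<and> total s \<le> b})"
    using assms(1) by (auto simp: Collect_conj_eq)
  moreover have "norm s \<le> b" if "s \<in> C \<inter> {s. a \<le> total s \<and> total s \<le> b}" for s
    using norm_le_total[of s] that assms(2) by auto
  ultimately show ?thesis by (auto simp: compact_eq_bounded_closed bounded_iff)
qed

lemma closed_orthant: "closed {0 :: real^'n::finite ..}"
proof -
  have "{0 :: real^'n ..} = (\<Inter>i. {s. 0 \<le> s $ i})" by (auto simp: less_eq_vec_def)
  then show ?thesis by (auto intro!: closed_INT closed_Collect_le continuous_intros)
qed

text \<open>Rescaling \<open>f s\<close> to total \<open>R\<close> gives a continuous self-map of a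
  simplex; Brouwer's fixed point \<open>s\<close> has eigenvalue \<open>total (f s) / R\<close>.
  Positivity of \<open>f\<close> keeps the divisor away from 0.\<close>

lemma positive_map_eigenvector:
  fixes f :: "real^'n::finite \<Rightarrow> real^'n"
  assumes cont: "continuous_on {0..} f" and pos: "\<And>s i. 0 \<le> s \<Longrightarrow> total s = R \<Longrightarrow> 0 < f s $ i" and R: "0 < R"
  obtains s l where "0 \<le> s" "total s = R" "0 < l" "f s = l *\<^sub>R s"
proof -
  define D where "D = {0..} \<inter> {s :: real^'n. R \<le> total s \<and> total s \<le> R}"
  have D: "s \<in> D \<longleftrightarrow> 0 \<le> s \<and> total s = R" for s by (auto simp: D_def)
  define h where "h s = (R / total (f s)) *\<^sub>R f s" for s
  have f: "0 < total (f s)" if "s \<in> D" for s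
    using pos that D by (intro sum_pos) auto
  have "\<exists>s\<in>D. h s = s"
  proof (rule brouwer)
    show "compact D" unfolding D_def by (rule compact_total_between) (auto simp: closed_orthant)
    show "convex D"
    proof (rule convexI)
      fix x y and u v :: real
      assume xy: "x \<in> D" "y \<in> D" and uv: "0 \<le> u" "0 \<le> v" "u + v = 1"
      have "total (u *\<^sub>R x + v *\<^sub>R y) = u * total x + v * total y"
        by (simp add: sum.distrib sum_distrib_left)
      also have "\<dots> = R" using xy uv(3) by (simp add: D flip: distrib_right)
      finally show "u *\<^sub>R x + v *\<^sub>R y \<in> D"
        using xy uv by (simp add: D less_eq_vec_def)
    qed
    have "(\<chi> i. R / real CARD('n)) \<in> D" using R by (auto simp: D less_eq_vec_def)
    then show "D \<noteq> {}" by blast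
    have "continuous_on D f" by (rule continuous_on_subset[OF cont]) (auto simp: D_def)
    then show "continuous_on D h"
      unfolding h_def by (intro continuous_intros) (use f in \<open>auto simp: less_le\<close>)
    show "h \<in> D \<rightarrow> D"
    proof
      fix s assume s: "s \<in> D"
      have "0 \<le> h s" using pos D s f[OF s] R by (auto simp: h_def less_eq_vec_def intro!: mult_nonneg_nonneg divide_nonneg_pos less_imp_le)
      moreover have "total (h s) = R" using f[OF s] by (simp add: h_def flip: sum_distrib_left sum_divide_distrib)
      ultimately show "h s \<in> D" by (simp add: D)
    qed
  qed blast
  then obtain s where s: "s \<in> D" "h s = s" by blast
  have "f s = (total (f s) / R) *\<^sub>R h s" using f[OF s(1)] R by (simp add: h_def)
  then show thesis using that[of s "total (f s) / R"] s D R f by simp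
qed

text \<open>Positivity of \<phi> keeps images of nonzero points off the boundary of the orthant.
  Unboundedness of \<phi> makes \<open>T\<close> proper: a bound on any single component of
  \<open>T s\<close> bounds \<open>s\<close>.\<close>

locale lower_bounded_map =
  fixes T :: "real^'n::finite \<Rightarrow> real^'n" and \<phi> :: "real \<Rightarrow> real"
  assumes cont: "continuous_on {0..} T"
    and mono: "0 \<le> x \<Longrightarrow> x \<le> y \<Longrightarrow> T x \<le> T y"
    and nonneg: "0 \<le> x \<Longrightarrow> 0 \<le> T x"
    and not_ge: "not_ge_id T"
    and lower: "0 \<le> x \<Longrightarrow> \<phi> (total x) \<le> T x $ i"
    and \<phi>_pos: "0 < r \<Longrightarrow> 0 < \<phi> r"
    and \<phi>_mono: "0 \<le> r \<Longrightarrow> r \<le> r' \<Longrightarrow> \<phi> r \<le> \<phi> r'"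
    and \<phi>_large: "\<exists>r>0. B < \<phi> r"
begin

lemma eq_0: "0 \<le> s \<Longrightarrow> s \<le> T s \<Longrightarrow> s = 0"
  using not_ge by (auto simp: not_ge_id_def)

text \<open>By monotonicity \<open>T 0\<close> lies below its own image.\<close>

lemma map_0: "T 0 = 0"
  using eq_0[of "T 0"] mono[of 0 "T 0"] nonneg[of 0] by simp

lemma map_pos: "0 \<le> s \<Longrightarrow> s \<noteq> 0 \<Longrightarrow> 0 < T s $ i"
  using total_pos[of s] \<phi>_pos[of "total s"] lower[of s i] by simp

lemma total_bound:
  obtains r where "0 < r" "\<And>s i. 0 \<le> s \<Longrightarrow> T s $ i \<le> B \<Longrightarrow> total s \<le> r"
proof -
  obtain r where r: "0 < r" "B < \<phi> r" using \<phi>_large by blast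
  have "total s \<le> r" if "0 \<le> s" "T s $ i \<le> B" for s i
    using lower[OF that(1), of i] \<phi>_mono[of r "total s"] r that(2) by linarith
  with r that show thesis by blast
qed

lemma limit_eq_0:
  assumes "\<And>k::nat. 0 \<le> x k" "x \<longlonglongrightarrow> L" "(\<lambda>k. T (x k)) \<longlonglongrightarrow> L"
  shows "L = 0"
proof -
  have L: "L \<in> {0..}"
    by (rule closed_sequentially[OF closed_orthant _ assms(2)]) (use assms(1) in auto)
  have "(\<lambda>k. T (x k)) \<longlonglongrightarrow> T L"
    using continuous_on_tendsto_compose[OF cont assms(2) L] assms(1) by simp
  then have "T L = L" using assms(3) LIMSEQ_unique by blast
  then show ?thesis using eq_0[of L] L by simp
qed

section \<open>Strict enlargement of the map\<close>

definition gap :: "real^'n \<Rightarrow> real" where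
  "gap v = Max (range (\<lambda>i. v $ i - T v $ i))"

lemma le_gap: "v $ i - T v $ i \<le> gap v"
  by (simp add: gap_def)

lemma gap_attained: obtains i where "gap v = v $ i - T v $ i"
proof -
  have "gap v \<in> range (\<lambda>i. v $ i - T v $ i)" unfolding gap_def by (rule Max_in) auto
  then show thesis using that by blast
qed

lemma gap_pos: "0 \<le> v \<Longrightarrow> v \<noteq> 0 \<Longrightarrow> 0 < gap v"
proof -
  assume "0 \<le> v" "v \<noteq> 0"
  then have "\<not> v \<le> T v" using eq_0 by blast
  then obtain i where "0 < v $ i - T v $ i" by (auto simp: less_eq_vec_def not_le)
  then show ?thesis using le_gap[of v i] by linarith
qed

text \<open>A pair records a value of a component of \<open>T\<close> and a height by which raising
  it is critical: if every component of \<open>T v\<close> is raised by less than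
  \<open>gap v\<close>, the component attaining the gap still decays. The distance of
  \<open>(t, 0)\<close> to this set is an admissible raise at value \<open>t\<close>, and it is
  automatically 1-Lipschitz in \<open>t\<close>, unlike an infimum of gaps over a level set.\<close>

definition gap_points :: "(real \<times> real) set" where
  "gap_points = {(T v $ i, gap v) | v i. 0 \<le> v \<and> T v $ i \<le> v $ i}"

text \<open>Otherwise there are points whose gaps tend to 0 while a component of their images tends
  to \<open>t\<close>. Properness bounds these points, and a limit \<open>l\<close> satisfies
  \<open>l \<le> T l\<close>. So \<open>l = 0\<close>, and the images tend to 0 instead of keeping a
  component near \<open>t\<close>.\<close>

lemma infdist_gap_points_pos:
  assumes "0 < t"
  shows "0 < infdist (t, 0) gap_points"
proof (rule ccontr)
  assume "\<not> 0 < infdist (t, 0) gap_points"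
  moreover have "gap_points \<noteq> {}" by (force simp: gap_points_def map_0)
  ultimately have "(t, 0) \<in> closure gap_points"
    using infdist_nonneg[of "(t, 0)" gap_points] by (simp add: in_closure_iff_infdist_zero)
  then obtain p where p: "\<And>k::nat. p k \<in> gap_points" "p \<longlonglongrightarrow> (t, 0)"
    by (auto simp: closure_sequential)
  then have "\<forall>k. \<exists>v i. p k = (T v $ i, gap v) \<and> 0 \<le> v" by (fastforce simp: gap_points_def)
  then obtain v i where v: "\<And>k. p k = (T (v k) $ i k, gap (v k))" "\<And>k. 0 \<le> v k" by metis
  have lim: "(\<lambda>k. T (v k) $ i k) \<longlonglongrightarrow> t" "(\<lambda>k. gap (v k)) \<longlonglongrightarrow> 0"
    using tendsto_fst[OF p(2)] tendsto_snd[OF p(2)] by (simp_all add: v)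
  then obtain B where "\<And>k. \<bar>T (v k) $ i k\<bar> \<le> B"
    using convergent_imp_bounded[OF lim(1)] by (auto simp: bounded_iff)
  then have B: "T (v k) $ i k \<le> B" for k by (meson abs_le_D1)
  obtain r where "\<And>s i. 0 \<le> s \<Longrightarrow> T s $ i \<le> B \<Longrightarrow> total s \<le> r" using total_bound by blast
  then have vk: "\<forall>k. v k \<in> {0..} \<inter> {s. 0 \<le> total s \<and> total s \<le> r}"
    using v(2) B total_nonneg by blast
  have "compact ({0..} \<inter> {s :: real^'n. 0 \<le> total s \<and> total s \<le> r})"
    by (rule compact_total_between) (simp_all add: closed_orthant)
  from seq_compactE[OF compact_imp_seq_compact[OF this] vk]
  obtain l \<theta> where l: "l \<in> {0..}" and "strict_mono \<theta>" and lv: "(v \<circ> \<theta>) \<longlonglongrightarrow> l"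
    by blast
  have Tv: "(\<lambda>k. T (v (\<theta> k))) \<longlonglongrightarrow> T l"
    using continuous_on_tendsto_compose[OF cont lv l] v(2) by (simp add: o_def)
  have "l $ j \<le> T l $ j" for j
  proof -
    have "(\<lambda>k. v (\<theta> k) $ j - T (v (\<theta> k)) $ j) \<longlonglongrightarrow> l $ j - T l $ j"
      using lv Tv by (auto intro!: tendsto_intros simp: o_def)
    moreover have "(\<lambda>k. gap (v (\<theta> k))) \<longlonglongrightarrow> 0"
      using LIMSEQ_subseq_LIMSEQ[OF lim(2) \<open>strict_mono \<theta>\<close>] by (simp add: o_def)
    ultimately have "l $ j - T l $ j \<le> 0" by (rule LIMSEQ_le) (use le_gap in auto)
    then show ?thesis by simp
  qed
  then have "l = 0" using l eq_0[of l] by (simp add: less_eq_vec_def)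
  with Tv map_0 have "(\<lambda>k. T (v (\<theta> k))) \<longlonglongrightarrow> 0" by simp
  \<comment> \<open>The component index \<open>i (\<theta> k)\<close> varies with \<open>k\<close>;
    the norm controls all components at once.\<close>
  then have "(\<lambda>k. norm (T (v (\<theta> k)))) \<longlonglongrightarrow> 0" by (rule tendsto_norm_zero)
  then have "(\<lambda>k. T (v (\<theta> k)) $ i (\<theta> k)) \<longlonglongrightarrow> 0"
    by (rule Lim_null_comparison[rotated]) (rule always_eventually, rule allI, rule Finite_Cartesian_Product.norm_nth_le)
  moreover have "(\<lambda>k. T (v (\<theta> k)) $ i (\<theta> k)) \<longlonglongrightarrow> t"
    using LIMSEQ_subseq_LIMSEQ[OF lim(1) \<open>strict_mono \<theta>\<close>] by (simp add: o_def)
  ultimately show False using LIMSEQ_unique assms by blast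
qed

lemma strictly_larger_map:
  obtains T' where "lower_bounded_map T' \<phi>" "\<And>s. 0 \<le> s \<Longrightarrow> s \<noteq> 0 \<Longrightarrow> strictly_below (T s) (T' s)"
proof -
  \<comment> \<open>Half the distance stays strictly below the gap. As the distance is 1-Lipschitz,
    \<rho> is still nondecreasing.\<close>
  define \<rho> where "\<rho> t = t + infdist (t, 0) gap_points / 2" for t
  define T' where "T' s = (\<chi> i. \<rho> (T s $ i))" for s
  have \<rho>_ge: "t \<le> \<rho> t" for t by (simp add: \<rho>_def infdist_nonneg)
  have \<rho>_mono: "\<rho> t \<le> \<rho> t'" if "t \<le> t'" for t t'
  proof -
    have "infdist (t, 0) gap_points \<le> infdist (t', 0) gap_points + dist (t, 0::real) (t', 0)"
      by (rule infdist_triangle)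
    then show ?thesis using that by (simp add: \<rho>_def dist_Pair_Pair dist_real_def)
  qed
  have "lower_bounded_map T' \<phi>"
  proof
    show "continuous_on {0..} T'"
      unfolding T'_def \<rho>_def
      by (intro continuous_on_vec_lambda continuous_intros continuous_on_infdist cont) auto
    show "T' x \<le> T' y" if "0 \<le> x" "x \<le> y" for x y
      using mono[OF that] \<rho>_mono by (simp add: T'_def less_eq_vec_def)
    show "0 \<le> T' x" if "0 \<le> x" for x
      using nonneg[OF that] \<rho>_ge by (auto simp: T'_def less_eq_vec_def intro: order_trans)
    show "\<phi> (total x) \<le> T' x $ i" if "0 \<le> x" for x i
      using lower[OF that] \<rho>_ge by (auto simp: T'_def intro: order_trans)
    show "not_ge_id T'"
      unfolding not_ge_id_def
    proof (intro allI impI notI)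
      fix s assume s: "0 \<le> s" "s \<noteq> 0" "s \<le> T' s"
      \<comment> \<open>This component decays by the whole gap, so the raise by at most half of it
        cannot undo the decay.\<close>
      obtain i where i: "gap s = s $ i - T s $ i" by (rule gap_attained)
      have g: "0 < gap s" using gap_pos s by blast
      with i have "T s $ i \<le> s $ i" by simp
      with s have "(T s $ i, gap s) \<in> gap_points" unfolding gap_points_def by blast
      then have "infdist (T s $ i, 0) gap_points \<le> dist (T s $ i, 0::real) (T s $ i, gap s)"
        by (rule infdist_le)
      also have "\<dots> = gap s" using g by (simp add: dist_Pair_Pair dist_real_def)
      finally have "T' s $ i < s $ i" using g i by (simp add: T'_def \<rho>_def)
      then show False using s(3) by (simp add: less_eq_vec_def not_le[symmetric])
    qed
  qed (use \<phi>_pos \<phi>_mono \<phi>_large in auto)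
  moreover have "strictly_below (T s) (T' s)" if "0 \<le> s" "s \<noteq> 0" for s
    using infdist_gap_points_pos[OF map_pos[OF that]] by (simp add: strictly_below_def T'_def \<rho>_def)
  ultimately show thesis by (rule that)
qed

section \<open>Decay points and bi-infinite orbits\<close>

definition decay_set :: "(real^'n) set" where
  "decay_set = {s. 0 \<le> s \<and> T s \<le> s}"

text \<open>An eigenvector on the simplex is a decay point, because an eigenvalue of at least 1
  would give \<open>s \<le> T s\<close>.\<close>

lemma decay_set_total: "0 < R \<Longrightarrow> \<exists>s\<in>decay_set. total s = R"
proof -
  assume R: "0 < R"
  have "0 < T s $ i" if "0 \<le> s" "total s = R" for s i
    by (rule map_pos) (use that R in auto)
  then obtain s l where s: "0 \<le> s" "total s = R" "0 < l" "T s = l *\<^sub>R s"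
    using positive_map_eigenvector[OF cont] R by metis
  have "l < 1"
  proof (rule ccontr)
    assume "\<not> l < 1"
    then have "s \<le> T s" using s mult_right_mono[of 1 l] by (auto simp: less_eq_vec_def)
    then show False using eq_0 s R by fastforce
  qed
  then have "T s \<le> s" using s by (auto simp: less_eq_vec_def intro: mult_left_le_one_le)
  then show ?thesis using s by (auto simp: decay_set_def)
qed

text \<open>Properness is what matters: a convergent sequence of images comes from a bounded
  sequence of arguments, hence from a compact part of \<open>C\<close>.\<close>

lemma closed_image:
  assumes "closed C" "C \<subseteq> {0..}"
  shows "closed (T ` C)"
  unfolding closed_sequential_limits
proof (intro allI impI)
  fix y l assume y: "(\<forall>k::nat. y k \<in> T ` C) \<and> y \<longlonglongrightarrow> l"
  then have "\<forall>k. \<exists>x. x \<in> C \<and> y k = T x" by blast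
  from choice[OF this] obtain x where x: "\<And>k. x k \<in> C" "\<And>k. y k = T (x k)" by blast
  have "bounded (range y)" using convergent_imp_bounded y by blast
  then obtain B where B: "\<And>k. norm (y k) \<le> B" by (auto simp: bounded_iff)
  obtain r where r: "\<And>s i. 0 \<le> s \<Longrightarrow> T s $ i \<le> B \<Longrightarrow> total s \<le> r" using total_bound by blast
  have x0: "0 \<le> x k" for k using x(1)[of k] assms(2) by auto
  \<comment> \<open>Here \<open>undefined\<close> is just some index; bounding one component is
    enough to bound the argument.\<close>
  have "y k $ undefined \<le> B" for k
    using B[of k] component_le_norm_cart[of "y k" undefined] by linarith
  then have "total (x k) \<le> r" for k
    using r[OF x0] x(2) by metis
  then have yk: "y k \<in> T ` (C \<inter> {s. 0 \<le> total s \<and> total s \<le> r})" for k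
    using x x0 total_nonneg[OF x0, of k] by (intro image_eqI[of _ _ "x k"]) auto
  have "compact (T ` (C \<inter> {s. 0 \<le> total s \<and> total s \<le> r}))"
    by (intro compact_continuous_image compact_total_between continuous_on_subset[OF cont])
      (use assms in auto)
  then have "closed (T ` (C \<inter> {s. 0 \<le> total s \<and> total s \<le> r}))" by (rule compact_imp_closed)
  then have "l \<in> T ` (C \<inter> {s. 0 \<le> total s \<and> total s \<le> r})"
    using closed_sequentially yk y by blast
  then show "l \<in> T ` C" by blast
qed

text \<open>Points that end a chain of \<open>m\<close> applications of \<open>T\<close> started in
  \<open>decay_set\<close>. These closed sets decrease, and \<open>T\<close> maps their intersection
  onto itself, which is what backward orbits require.\<close>

abbreviation iterated :: "nat \<Rightarrow> (real^'n) set" where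
  "iterated m \<equiv> ((`) T ^^ m) decay_set"

lemma image_decay_set: "T ` decay_set \<subseteq> decay_set"
  using mono nonneg by (auto simp: decay_set_def)

lemma image_iterated: "T ` iterated m \<subseteq> iterated m"
proof (induction m)
  case 0
  then show ?case using image_decay_set by simp
next
  case (Suc m)
  then show ?case by (simp add: image_mono)
qed

lemma iterated_mono: "m \<le> k \<Longrightarrow> iterated k \<subseteq> iterated m"
  by (induction k rule: dec_induct) (use image_iterated in auto)

lemma iterated_nonneg: "iterated m \<subseteq> {0..}"
  using iterated_mono[of 0 m] by (auto simp: decay_set_def)

lemma closed_iterated: "closed (iterated m)"
proof (induction m)
  case 0
  have eq: "decay_set = (\<Inter>i. {s \<in> {0..}. T s $ i \<le> s $ i})"
    by (auto simp: decay_set_def less_eq_vec_def)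
  have "closed {s \<in> {0..}. T s $ i \<le> s $ i}" for i
    by (intro continuous_on_closed_Collect_le continuous_intros cont closed_orthant)
  then show ?case by (simp add: eq closed_INT del: atLeast_iff)
next
  case (Suc m)
  then show ?case using closed_image iterated_nonneg by simp
qed

lemma iterated_large: "\<exists>s\<in>iterated m. B < total s"
proof (induction m arbitrary: B)
  case 0
  have "0 < \<bar>B\<bar> + 1" by simp
  from decay_set_total[OF this] show ?case by force
next
  case (Suc m)
  obtain r where r: "0 < r" "B < \<phi> r" using \<phi>_large by blast
  obtain s where s: "s \<in> iterated m" "r < total s" using Suc by blast
  have "0 \<le> s" using s iterated_nonneg by auto
  then have "\<phi> (total s) \<le> total (T s)"
    using lower[of s undefined] component_le_total[of "T s" undefined] nonneg by fastforce
  then have "B < total (T s)" using r s \<phi>_mono[of r "total s"] by simp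
  then show ?case using s by auto
qed

lemma iterates_decay_set: "s \<in> decay_set \<Longrightarrow> (T ^^ k) s \<in> decay_set"
  by (induction k) (use image_decay_set in auto)

text \<open>Iterates of a decay point decrease in every component, so they converge to a fixed
  point, and 0 is the only one.\<close>

lemma iterates_small:
  assumes "s \<in> decay_set" "0 < e"
  shows "\<exists>k. total ((T ^^ k) s) < e"
proof -
  define x where "x k = (T ^^ k) s" for k
  have x: "0 \<le> x k" "x (Suc k) \<le> x k" for k
    using iterates_decay_set[OF assms(1), of k] by (auto simp: x_def decay_set_def)
  have "\<exists>l. (\<lambda>k. x k $ i) \<longlonglongrightarrow> l" for i
  proof -
    have "decseq (\<lambda>k. x k $ i)" using x(2) by (auto intro!: decseq_SucI simp: less_eq_vec_def)
    moreover have "\<forall>k. 0 \<le> x k $ i" using x(1) by (auto simp: less_eq_vec_def)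
    ultimately show ?thesis using decseq_convergent by metis
  qed
  then obtain l where l: "\<And>i. (\<lambda>k. x k $ i) \<longlonglongrightarrow> l i" by metis
  then have xl: "x \<longlonglongrightarrow> (\<chi> i. l i)" by (intro vec_tendstoI) simp
  then have "(\<lambda>k. T (x k)) \<longlonglongrightarrow> (\<chi> i. l i)" using LIMSEQ_Suc[OF xl] by (simp add: x_def)
  then have "x \<longlonglongrightarrow> 0" using limit_eq_0[OF x(1) xl] xl by simp
  then have "(\<lambda>k. total (x k)) \<longlonglongrightarrow> total (0 :: real^'n)" by (intro tendsto_intros)
  then have "eventually (\<lambda>k. total (x k) < e) sequentially"
    using assms(2) by (intro order_tendstoD) auto
  then show ?thesis by (auto simp: x_def eventually_sequentially)
qed

text \<open>Starting from a point of total above 1, stop at the first iterate of total at most 1.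
  Its predecessor still has total above 1, so the last step cannot fall below
  \<open>\<phi> 1\<close>. The window does not depend on \<open>m\<close>, so that a nonzero point
  survives in the intersection.\<close>

lemma iterated_middle: "\<exists>s\<in>iterated m. \<phi> 1 \<le> total s \<and> total s \<le> 1"
proof -
  obtain s where s: "s \<in> iterated m" "1 < total s" using iterated_large by blast
  have "s \<in> decay_set" using s iterated_mono[of 0 m] by auto
  then obtain k where "total ((T ^^ k) s) < 1" using iterates_small[of s 1] by auto
  then have ex: "\<exists>k. total ((T ^^ k) s) \<le> 1" using less_imp_le by blast
  define k where "k = (LEAST k. total ((T ^^ k) s) \<le> 1)"
  have k: "total ((T ^^ k) s) \<le> 1" unfolding k_def using LeastI_ex[OF ex] .
  have it: "(T ^^ j) s \<in> iterated m" for j by (induction j) (use s image_iterated in auto)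
  have "k \<noteq> 0" using k s by (intro notI) simp
  then obtain j where j: "k = Suc j" using not0_implies_Suc by blast
  then have "1 < total ((T ^^ j) s)"
    using not_less_Least[of j "\<lambda>k. total ((T ^^ k) s) \<le> 1"] by (simp add: k_def)
  moreover have "0 \<le> (T ^^ j) s" using it iterated_nonneg by fastforce
  ultimately have "\<phi> 1 \<le> T ((T ^^ j) s) $ i" for i
    using lower \<phi>_mono[of 1] by (meson less_imp_le order_trans zero_le_one)
  then have "\<phi> 1 \<le> total ((T ^^ k) s)"
    using component_le_total[OF nonneg[OF \<open>0 \<le> (T ^^ j) s\<close>], of undefined] j by (auto intro: order_trans)
  then show ?thesis using it k by blast
qed

lemma iterated_core_nonzero: "\<exists>s\<in>(\<Inter>m. iterated m). s \<noteq> 0"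
proof -
  define S where "S m = iterated m \<inter> {s. \<phi> 1 \<le> total s \<and> total s \<le> 1}" for m
  have "\<Inter>(range S) \<noteq> {}"
  proof (rule compact_nest)
    show "compact (S m)" for m
      unfolding S_def by (rule compact_total_between[OF closed_iterated iterated_nonneg])
    show "S m \<noteq> {}" for m using iterated_middle by (auto simp: S_def)
    show "S k \<subseteq> S m" if "m \<le> k" for m k using iterated_mono[OF that] by (auto simp: S_def)
  qed
  then obtain s where s: "\<And>m. s \<in> S m" by blast
  then have "s \<noteq> 0" using \<phi>_pos[of 1] by (auto simp: S_def)
  then show ?thesis using s by (auto simp: S_def)
qed

text \<open>The preimages of \<open>v\<close> within \<open>iterated m\<close> form nested compact
  sets, nonempty because \<open>v\<close> lies in \<open>iterated (Suc m)\<close>.\<close>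

lemma iterated_core_preimage:
  assumes v: "v \<in> (\<Inter>m. iterated m)"
  shows "\<exists>u\<in>(\<Inter>m. iterated m). T u = v"
proof -
  define S where "S m = iterated m \<inter> {s \<in> {0..}. T s = v}" for m
  obtain r where "\<And>s i. 0 \<le> s \<Longrightarrow> T s $ i \<le> norm v \<Longrightarrow> total s \<le> r" using total_bound by blast
  then have r: "total s \<le> r" if "0 \<le> s" "T s = v" for s
    using that abs_le_D1[OF component_le_norm_cart[of v undefined]] by blast
  have "\<Inter>(range S) \<noteq> {}"
  proof (rule compact_nest)
    fix m
    have "{s \<in> {0..}. T s = v} = {0..} \<inter> T -` {v}" by auto
    then have "closed {s \<in> {0..}. T s = v}"
      using continuous_closed_preimage[OF cont closed_orthant closed_singleton] by (simp only:)
    then have "closed (S m)" unfolding S_def using closed_iterated by blast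
    then have "compact (S m \<inter> {s. 0 \<le> total s \<and> total s \<le> r})"
      by (rule compact_total_between) (auto simp: S_def)
    moreover have "S m \<inter> {s. 0 \<le> total s \<and> total s \<le> r} = S m"
      using r total_nonneg by (auto simp: S_def)
    ultimately show "compact (S m)" by simp
    have "v \<in> T ` iterated m" using INT_D[OF v, of "Suc m"] by simp
    then show "S m \<noteq> {}" using iterated_nonneg[of m] by (auto simp: S_def)
  next
    show "S k \<subseteq> S m" if "m \<le> k" for m k using iterated_mono[OF that] by (auto simp: S_def)
  qed
  then show ?thesis by (auto simp: S_def)
qed

text \<open>From a nonzero point of the intersection, chosen preimages supply the positive indices
  and iterates of \<open>T\<close> the negative ones. All points are decay points, which is why the
  orbit increases. If its totals were bounded, the limit would be a fixed point, hence 0, although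
  the totals never fall below \<open>total (x 0)\<close> on the positive side.\<close>

lemma orbit:
  obtains z :: "int \<Rightarrow> real^'n" where "\<And>m. 0 \<le> z m" "\<And>m. z m \<noteq> 0" "\<And>m. T (z (m + 1)) = z m"
    "\<And>m. z m \<le> z (m + 1)" "\<And>e. 0 < e \<Longrightarrow> \<exists>m. total (z m) < e" "\<And>B. \<exists>m. B < total (z m)"
proof -
  define Q where "Q = (\<Inter>m. iterated m)"
  have Q: "Q \<subseteq> decay_set" unfolding Q_def by (rule INF_lower2[of 0]) auto
  obtain s where s: "s \<in> Q" "s \<noteq> 0" using iterated_core_nonzero by (auto simp: Q_def)
  obtain p where p: "\<And>v. v \<in> Q \<Longrightarrow> p v \<in> Q" "\<And>v. v \<in> Q \<Longrightarrow> T (p v) = v"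
    using iterated_core_preimage unfolding Q_def by metis
  define x where "x k = (p ^^ k) s" for k
  have xQ: "x k \<in> Q" for k unfolding x_def by (induction k) (use s p in auto)
  have x: "T (x (Suc k)) = x k" for k using p(2)[OF xQ[of k]] by (simp add: x_def)
  have x0: "x k \<noteq> 0" for k
  proof (induction k)
    case 0
    then show ?case using s by (simp add: x_def)
  next
    case (Suc k)
    then show ?case using x[of k] map_0 by metis
  qed
  define z where "z m = (if 0 \<le> m then x (nat m) else (T ^^ nat (- m)) s)" for m
  have zx: "z (int k) = x k" for k by (simp add: z_def)
  have zy: "z (- int k) = (T ^^ k) s" for k by (cases k) (simp_all add: z_def x_def del: of_nat_Suc funpow.simps(2))
  have ind: "P (z m)" if "\<And>k. P (x k)" "\<And>k. P ((T ^^ k) s)" for P m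
    using that by (simp add: z_def)
  have T0: "(T ^^ k) s \<noteq> 0 \<and> (T ^^ k) s \<in> decay_set" for k
  proof (induction k)
    case 0
    then show ?case using s Q by auto
  next
    case (Suc k)
    then have "0 < T ((T ^^ k) s) $ undefined" by (intro map_pos) (auto simp: decay_set_def)
    then have "T ((T ^^ k) s) \<noteq> 0" by auto
    then show ?case using Suc image_decay_set by auto
  qed
  have z: "z m \<in> decay_set" "z m \<noteq> 0" for m
    using ind[of "\<lambda>u. u \<in> decay_set \<and> u \<noteq> 0" m] T0 xQ x0 Q by auto
  have Tz: "T (z (m + 1)) = z m" for m
  proof (cases "0 \<le> m")
    case True
    then have "nat (m + 1) = Suc (nat m)" by simp
    then show ?thesis using x True by (simp add: z_def)
  next
    case False
    then have "m = - int (Suc (nat (- m - 1)))" "m + 1 = - int (nat (- m - 1))" by auto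
    then show ?thesis using zy by (metis funpow.simps(2) o_apply)
  qed
  have up: "z m \<le> z (m + 1)" for m using z(1)[of "m + 1"] Tz[of m] by (simp add: decay_set_def)
  have nonneg_z: "0 \<le> z m" for m using z by (auto simp: decay_set_def)
  show thesis
  proof
    show "\<exists>m. total (z m) < e" if "0 < e" for e
      using iterates_small[OF _ that] s Q zy by (metis subsetD)
    show "\<exists>m. B < total (z m)" for B
    proof (rule ccontr)
      assume "\<nexists>m. B < total (z m)"
      then have B: "total (z m) \<le> B" for m by (meson not_le)
      have "\<exists>l. (\<lambda>k. x k $ i) \<longlonglongrightarrow> l" for i
      proof -
        have "x k $ i \<le> x (Suc k) $ i" for k
          using up[of "int k"] zx[of k] zx[of "Suc k"] by (simp add: less_eq_vec_def add.commute)
        then have "incseq (\<lambda>k. x k $ i)" by (rule incseq_SucI)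
        moreover have "\<forall>k. x k $ i \<le> B"
          using component_le_total[OF nonneg_z] B zx by (metis order_trans)
        ultimately show ?thesis using incseq_convergent by metis
      qed
      then obtain l where l: "\<And>i. (\<lambda>k. x k $ i) \<longlonglongrightarrow> l i" by metis
      then have xl: "x \<longlonglongrightarrow> (\<chi> i. l i)" by (intro vec_tendstoI) simp
      have "(\<lambda>k. T (x (Suc k))) \<longlonglongrightarrow> (\<chi> i. l i)" using x xl by simp
      moreover have "0 \<le> x (Suc k)" for k using nonneg_z zx by metis
      ultimately have "(\<chi> i. l i) = 0" using limit_eq_0[OF _ LIMSEQ_Suc[OF xl]] by blast
      with xl have x_lim: "(\<lambda>k. total (x k)) \<longlonglongrightarrow> 0"
        using tendsto_sum[of UNIV "\<lambda>i k. x k $ i" "\<lambda>i. 0"] tendsto_vec_nth[of x 0 sequentially] by simp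
      have "total (x 0) \<le> total (x k)" for k
      proof (induction k)
        case (Suc k)
        have "total (x k) \<le> total (x (Suc k))"
          using up[of "int k"] zx[of k] zx[of "Suc k"]
          by (intro sum_mono) (simp add: less_eq_vec_def add.commute)
        with Suc show ?case by simp
      qed simp
      then have "total (x 0) \<le> 0" using x_lim by (intro LIMSEQ_le_const) auto
      moreover have "0 < total (x 0)" using total_pos[of "x 0"] nonneg_z[of 0] x0[of 0] zx[of 0] by simp
      ultimately show False by simp
    qed
  qed (use nonneg_z z Tz up in auto)
qed

end

text \<open>For an orbit \<open>z\<close> of \<open>T'\<close>, the strict gap reads
  \<open>T (z (m + 1)) < z m\<close> in every component, and \<open>w m\<close> is placed strictly
  between the two. Then \<open>T (w (m + 1)) \<le> T (z (m + 1)) < w m\<close>.\<close>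

lemma decay_chain_of_orbit:
  fixes T T' :: "real^'n::finite \<Rightarrow> real^'n"
  assumes T: "lower_bounded_map T \<phi>" and T': "lower_bounded_map T' \<phi>"
    and less: "\<And>s. 0 \<le> s \<Longrightarrow> s \<noteq> 0 \<Longrightarrow> strictly_below (T s) (T' s)"
  shows "\<exists>w. decay_chain T w"
proof -
  interpret T: lower_bounded_map T \<phi> by fact
  interpret T': lower_bounded_map T' \<phi> by fact
  obtain z :: "int \<Rightarrow> real^'n" where z: "\<And>m. 0 \<le> z m" "\<And>m. z m \<noteq> 0" "\<And>m. T' (z (m + 1)) = z m"
    "\<And>m. z m \<le> z (m + 1)" "\<And>e. 0 < e \<Longrightarrow> \<exists>m. total (z m) < e" "\<And>B. \<exists>m. B < total (z m)"
    by (rule T'.orbit) blast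
  \<comment> \<open>Any strictly decreasing weights between 0 and 1 would do: as \<open>m\<close>
    grows, \<open>w m\<close> moves closer to its upper end, which makes the chain strictly
    increasing although \<open>z\<close> is only weakly so.\<close>
  define \<theta> :: "int \<Rightarrow> real" where "\<theta> m = 1 / (1 + 2 powi m)" for m
  have pw: "(0::real) < 2 powi m" "(2::real) powi m < 2 powi (m + 1)" for m :: int
    by (auto simp: power_int_add)
  then have "0 < 1 + (2::real) powi m" for m :: int by (simp add: add_pos_pos)
  then have \<theta>: "0 < \<theta> m" "\<theta> m < 1" "\<theta> (m + 1) < \<theta> m" for m
    using pw[of m] pw(1)[of "m + 1"] by (auto simp: \<theta>_def divide_simps)
  define w where "w m = (1 - \<theta> m) *\<^sub>R z m + \<theta> m *\<^sub>R T (z (m + 1))" for m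
  have Tz: "T (z (m + 1)) $ i < z m $ i" for m i
    using less[OF z(1,2), of "m + 1"] z(3)[of m] by (simp add: strictly_below_def)
  have w_eq: "w m $ i = z m $ i - \<theta> m * (z m $ i - T (z (m + 1)) $ i)" for m i
    by (simp add: w_def algebra_simps)
  have w_less: "w m $ i < z m $ i" for m i
    using Tz[of m i] \<theta>(1)[of m] by (simp add: w_eq)
  have w_greater: "T (z (m + 1)) $ i < w m $ i" for m i
  proof -
    have "0 < (1 - \<theta> m) * (z m $ i - T (z (m + 1)) $ i)"
      by (rule mult_pos_pos) (use Tz \<theta>(2) in auto)
    then show ?thesis unfolding w_eq by (simp add: algebra_simps)
  qed
  have T_pos: "0 < T (z m) $ i" for m i using T.map_pos z by blast
  have w_pos: "0 < w m $ i" for m i using w_greater T_pos less_trans by blast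
  then have w_nonneg: "0 \<le> w m" for m by (simp add: less_eq_vec_def less_imp_le)
  have z_mono: "z m $ i \<le> z (m + 1) $ i" and Tz_mono: "T (z m) $ i \<le> T (z (m + 1)) $ i" for m i
    using z(4) T.mono[OF z(1) z(4)] by (simp_all add: less_eq_vec_def)
  have "w m $ i < w (m + 1) $ i" for m i
  proof -
    have "w m $ i = (1 - \<theta> m) * z m $ i + \<theta> m * T (z (m + 1)) $ i" by (simp add: w_def)
    also have "\<dots> \<le> (1 - \<theta> m) * z (m + 1) $ i + \<theta> m * T (z (m + 1 + 1)) $ i"
      by (intro add_mono mult_left_mono z_mono Tz_mono) (use \<theta>[of m] in auto)
    also have "\<dots> = z (m + 1) $ i - \<theta> m * (z (m + 1) $ i - T (z (m + 1 + 1)) $ i)"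
      by (simp add: algebra_simps)
    also have "\<dots> < w (m + 1) $ i"
      unfolding w_eq using \<theta>(3)[of m] Tz[of "m + 1" i]
      by (intro diff_strict_left_mono mult_strict_right_mono) simp_all
    finally show ?thesis .
  qed
  moreover have "T (w (m + 1)) $ i < w m $ i" for m i
  proof -
    have "w (m + 1) \<le> z (m + 1)" using w_less by (simp add: less_eq_vec_def less_imp_le)
    then have "T (w (m + 1)) $ i \<le> T (z (m + 1)) $ i"
      using T.mono[OF w_nonneg] by (simp add: less_eq_vec_def)
    then show ?thesis using w_greater by (rule le_less_trans)
  qed
  moreover have "\<exists>m. w m $ i < e" if e: "0 < e" for i e
    using z(5)[OF e] w_less component_le_total[OF z(1)] by (meson less_le_trans less_trans order.strict_trans1 less_imp_le)
  moreover have "\<exists>m. B < w m $ i" for i B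
  proof -
    \<comment> \<open>Only the totals of \<open>z\<close> are known to be unbounded. The lower bound
      passes this on to every component of \<open>T (z m)\<close>, and \<open>w (m - 1)\<close> lies
      above \<open>T (z m)\<close>.\<close>
    obtain r where r: "\<And>s i. 0 \<le> s \<Longrightarrow> T s $ i \<le> B \<Longrightarrow> total s \<le> r" using T.total_bound by blast
    obtain m where "r < total (z m)" using z(6) by blast
    then have "B < T (z m) $ i" using r[OF z(1), of m i] by (meson not_le)
    then have "B < w (m - 1) $ i" using w_greater[of "m - 1" i] by simp
    then show ?thesis by blast
  qed
  ultimately have "decay_chain T w" using w_pos unfolding decay_chain_def strictly_below_def by auto
  then show ?thesis by blast
qed

lemma (in lower_bounded_map) exists_decay_chain: "\<exists>w. decay_chain T w"
  using strictly_larger_map decay_chain_of_orbit[OF lower_bounded_map_axioms] by metis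

section \<open>Lower bounds preserving the small gain condition\<close>

text \<open>The formula for \<phi> is a one-sided inf-convolution: the largest nondecreasing
  1-Lipschitz function satisfying \<open>\<phi> (q v) \<le> m v\<close>. It replaces the infimum of
  \<open>m\<close> over \<open>q v \<ge> r\<close>, which need not be continuous in
  \<open>r\<close>.\<close>

lemma lower_modulus:
  fixes m q :: "'a \<Rightarrow> real"
  assumes "A \<noteq> {}" and nonneg: "\<And>v. v \<in> A \<Longrightarrow> 0 \<le> m v"
    and pos: "\<And>R. 0 < R \<Longrightarrow> \<exists>\<delta>>0. \<forall>v\<in>A. R \<le> q v \<longrightarrow> \<delta> \<le> m v"
    and large: "\<And>B. \<exists>R. \<forall>v\<in>A. R \<le> q v \<longrightarrow> B \<le> m v"
  obtains \<phi> :: "real \<Rightarrow> real" where "continuous_on UNIV \<phi>" "mono \<phi>" "\<And>r. 0 < r \<Longrightarrow> 0 < \<phi> r"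
    "\<And>B. \<exists>r>0. B < \<phi> r" "\<And>v. v \<in> A \<Longrightarrow> \<phi> (q v) \<le> m v"
proof -
  define f where "f r v = m v + max 0 (r - q v)" for r v
  define \<phi> where "\<phi> r = (INF v\<in>A. f r v)" for r
  have "bdd_below (f r ` A)" for r
    by (rule bdd_belowI[of _ 0]) (use nonneg in \<open>auto simp: f_def\<close>)
  then have le: "\<phi> r \<le> f r v" if "v \<in> A" for r v
    unfolding \<phi>_def using that by (rule cINF_lower)
  have ge: "c \<le> \<phi> r" if "\<And>v. v \<in> A \<Longrightarrow> c \<le> f r v" for c r
    unfolding \<phi>_def using assms(1) that by (rule cINF_greatest)
  have lip: "\<phi> r \<le> \<phi> r' + max 0 (r - r')" for r r'
  proof -
    have "\<phi> r - max 0 (r - r') \<le> f r' v" if "v \<in> A" for v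
      using le[OF that, of r] unfolding f_def by linarith
    then have "\<phi> r - max 0 (r - r') \<le> \<phi> r'" by (rule ge)
    then show ?thesis by linarith
  qed
  have "\<bar>\<phi> r - \<phi> r'\<bar> \<le> 1 * \<bar>r - r'\<bar>" for r r'
    using lip[of r r'] lip[of r' r] by (cases "r \<le> r'") simp_all
  then have "1-lipschitz_on UNIV \<phi>" by (intro lipschitz_onI) (auto simp: dist_real_def)
  then have "continuous_on UNIV \<phi>" by (rule lipschitz_on_continuous_on)
  moreover have "mono \<phi>"
  proof
    fix r r' :: real assume "r \<le> r'"
    then show "\<phi> r \<le> \<phi> r'" using lip[of r r'] by simp
  qed
  moreover have "0 < \<phi> r" if r: "0 < r" for r
  proof -
    obtain \<delta> where \<delta>: "0 < \<delta>" "\<And>v. v \<in> A \<Longrightarrow> r/2 \<le> q v \<Longrightarrow> \<delta> \<le> m v"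
      using pos[of "r/2"] r by auto
    \<comment> \<open>Either \<open>q v \<ge> r/2\<close>, and \<open>m v\<close> is at least
      \<delta>, or the penalty \<open>r - q v\<close> exceeds \<open>r/2\<close>.\<close>
    have "min \<delta> (r/2) \<le> \<phi> r"
    proof (rule ge)
      fix v assume v: "v \<in> A"
      show "min \<delta> (r/2) \<le> f r v"
        using \<delta>(2)[OF v] nonneg[OF v] unfolding f_def by linarith
    qed
    then show ?thesis using \<delta>(1) r by linarith
  qed
  moreover have "\<exists>r>0. B < \<phi> r" for B
  proof -
    obtain R where R: "\<And>v. v \<in> A \<Longrightarrow> R \<le> q v \<Longrightarrow> B + 1 \<le> m v" using large by blast
    \<comment> \<open>Points with \<open>q v < R\<close> now incur a penalty of at least
      \<open>B + 1\<close>; the inner maximum with 1 keeps \<open>r\<close> positive.\<close>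
    define r where "r = max R 0 + max (B + 1) 1"
    have "B + 1 \<le> \<phi> r"
    proof (rule ge)
      fix v assume v: "v \<in> A"
      show "B + 1 \<le> f r v"
        using R[OF v] nonneg[OF v] unfolding f_def r_def by linarith
    qed
    then show ?thesis by (intro exI[of _ r]) (simp add: r_def add_nonneg_pos)
  qed
  moreover have "\<phi> (q v) \<le> m v" if "v \<in> A" for v
    using le[OF that, of "q v"] by (simp add: f_def)
  ultimately show thesis by (rule that)
qed

text \<open>On the shell of totals between \<open>R\<close> and \<open>R'\<close> the function
  attains a positive minimum by compactness; beyond \<open>R'\<close> growth takes over.\<close>

lemma lower_modulus_total:
  fixes m :: "real^'n::finite \<Rightarrow> real"
  assumes cont: "continuous_on {0..} m" and nonneg: "\<And>v. 0 \<le> v \<Longrightarrow> 0 \<le> m v"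
    and pos: "\<And>v. 0 \<le> v \<Longrightarrow> v \<noteq> 0 \<Longrightarrow> 0 < m v"
    and large: "\<And>B. \<exists>R. \<forall>v\<ge>0. R \<le> total v \<longrightarrow> B \<le> m v"
  obtains \<phi> :: "real \<Rightarrow> real" where "continuous_on UNIV \<phi>" "mono \<phi>" "\<And>r. 0 < r \<Longrightarrow> 0 < \<phi> r"
    "\<And>B. \<exists>r>0. B < \<phi> r" "\<And>v. 0 \<le> v \<Longrightarrow> \<phi> (total v) \<le> m v"
proof -
  have "\<exists>\<delta>>0. \<forall>v\<in>{0..}. R \<le> total v \<longrightarrow> \<delta> \<le> m v" if R: "0 < R" for R
  proof -
    obtain R' where R': "\<And>v. 0 \<le> v \<Longrightarrow> R' \<le> total v \<Longrightarrow> 1 \<le> m v" using large by blast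
    define C where "C = {0..} \<inter> {s :: real^'n. R \<le> total s \<and> total s \<le> R'}"
    have C: "compact C" unfolding C_def by (rule compact_total_between) (simp_all add: closed_orthant)
    have "\<exists>\<delta>>0. \<forall>v\<in>C. \<delta> \<le> m v"
    proof (cases "C = {}")
      case False
      have "continuous_on C m" by (rule continuous_on_subset[OF cont]) (auto simp: C_def)
      then obtain u where u: "u \<in> C" "\<And>v. v \<in> C \<Longrightarrow> m u \<le> m v"
        using continuous_attains_inf[OF C False] by blast
      have "0 < m u" by (rule pos) (use u R in \<open>auto simp: C_def\<close>)
      then show ?thesis using u by blast
    qed (auto intro: exI[of _ 1])
    then obtain \<delta> where \<delta>: "0 < \<delta>" "\<And>v. v \<in> C \<Longrightarrow> \<delta> \<le> m v" by blast
    have "min \<delta> 1 \<le> m v" if "0 \<le> v" "R \<le> total v" for v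
      using \<delta>(2)[of v] R'[of v] that by (cases "total v \<le> R'") (auto simp: C_def)
    then show ?thesis using \<delta>(1) by (intro exI[of _ "min \<delta> 1"]) auto
  qed
  then have pos': "\<exists>\<delta>>0. \<forall>v\<in>{0..}. R \<le> total v \<longrightarrow> \<delta> \<le> m v" if "0 < R" for R using that by blast
  have large': "\<exists>R. \<forall>v\<in>{0..}. R \<le> total v \<longrightarrow> B \<le> m v" for B using large[of B] by auto
  show thesis
    by (rule lower_modulus[of "{0..}" m total, OF _ _ pos' large'])
      (use nonneg that in auto)
qed

text \<open>Raising \<open>T\<close> to \<open>\<phi>\<close> of the total only strengthens the inequality to be satisfied along the path,
  so the small gain condition of the raised map is all that remains to be checked.\<close>

lemma Omega_path_of_raised_map:
  fixes T :: "real^'n::finite \<Rightarrow> real^'n"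
  assumes cont: "continuous_on {0..} T"
    and mono: "\<And>x y. 0 \<le> x \<Longrightarrow> x \<le> y \<Longrightarrow> T x \<le> T y"
    and nonneg: "\<And>x. 0 \<le> x \<Longrightarrow> 0 \<le> T x"
    and \<phi>: "continuous_on UNIV \<phi>" "mono \<phi>" "\<And>r. 0 < r \<Longrightarrow> 0 < \<phi> r" "\<And>B. \<exists>r>0. B < \<phi> r"
    and not_ge: "\<And>s. 0 \<le> s \<Longrightarrow> s \<noteq> 0 \<Longrightarrow> (\<And>i. s $ i \<le> max (T s $ i) (\<phi> (total s))) \<Longrightarrow> False"
  shows "\<exists>\<sigma>. Omega_path T \<sigma>"
proof -
  define T' where "T' s = (\<chi> i. max (T s $ i) (\<phi> (total s)))" for s
  have "lower_bounded_map T' \<phi>"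
  proof
    show "continuous_on {0..} T'"
      unfolding T'_def
      by (intro continuous_on_vec_lambda continuous_intros cont continuous_on_compose2[OF \<phi>(1)]) auto
    show "T' x \<le> T' y" if "0 \<le> x" "x \<le> y" for x y
    proof -
      have "total x \<le> total y" using that(2) by (intro sum_mono) (simp add: less_eq_vec_def)
      then have "\<phi> (total x) \<le> \<phi> (total y)" by (rule monoD[OF \<phi>(2)])
      then show ?thesis using mono[OF that] by (auto simp: T'_def less_eq_vec_def max.coboundedI1 max.coboundedI2)
    qed
    show "0 \<le> T' x" if "0 \<le> x" for x
      using nonneg[OF that] by (auto simp: T'_def less_eq_vec_def max.coboundedI1)
    show "not_ge_id T'"
      unfolding not_ge_id_def
    proof (intro allI impI notI)
      fix s assume "0 \<le> s" "s \<noteq> 0" "s \<le> T' s"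
      then show False using not_ge[of s] by (simp add: T'_def less_eq_vec_def)
    qed
    show "\<phi> (total x) \<le> T' x $ i" for x i by (simp add: T'_def)
    show "0 < \<phi> r" if "0 < r" for r using \<phi>(3) that .
    show "\<phi> r \<le> \<phi> r'" if "r \<le> r'" for r r' using monoD[OF \<phi>(2) that] .
    show "\<exists>r>0. B < \<phi> r" for B using \<phi>(4) .
  qed
  then obtain w where w: "decay_chain T' w" using lower_bounded_map.exists_decay_chain by blast
  have "T s $ i \<le> T' s $ i" for s i by (simp add: T'_def)
  with w have "decay_chain T w"
    unfolding decay_chain_def strictly_below_def by (meson order.strict_trans1)
  with mono show ?thesis by (rule decay_chain_imp_Omega_path)
qed

section \<open>Bounded maps\<close>

text \<open>The quantity \<open>g v\<close> is the total excess of \<open>v\<close> over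
  \<open>T v\<close>: positive off 0 by the small gain condition, and unbounded because
  \<open>T\<close> is bounded.\<close>

lemma Omega_path_bounded:
  fixes T :: "real^'n::finite \<Rightarrow> real^'n"
  assumes cont: "continuous_on {0..} T"
    and mono: "\<And>x y. 0 \<le> x \<Longrightarrow> x \<le> y \<Longrightarrow> T x \<le> T y"
    and nonneg: "\<And>x. 0 \<le> x \<Longrightarrow> 0 \<le> T x"
    and not_ge: "not_ge_id T" and bound: "\<And>x i. 0 \<le> x \<Longrightarrow> T x $ i \<le> B"
  shows "\<exists>\<sigma>. Omega_path T \<sigma>"
proof -
  define n where "n = real CARD('n)"
  have n: "0 < n" by (simp add: n_def)
  define g where "g v = (\<Sum>i\<in>UNIV. max 0 (v $ i - T v $ i))" for v
  \<comment> \<open>If \<open>s\<close> violated the raised condition, each of its \<open>n\<close>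
    excesses would be at most \<open>m s\<close>, so together they could not reach
    \<open>g s\<close>.\<close>
  define m where "m v = g v / (2 * n)" for v
  have g_nonneg: "0 \<le> g v" for v by (auto simp: g_def intro: sum_nonneg)
  have g_pos: "0 < g v" if "0 \<le> v" "v \<noteq> 0" for v
  proof -
    have "\<not> v \<le> T v" using not_ge that by (auto simp: not_ge_id_def)
    then obtain i where "T v $ i < v $ i" by (auto simp: less_eq_vec_def not_le)
    then show ?thesis unfolding g_def by (intro sum_pos2[of _ i]) auto
  qed
  have "continuous_on {0..} m"
    unfolding m_def g_def using n by (intro continuous_intros cont) auto
  moreover have "0 \<le> m v" for v using g_nonneg n by (simp add: m_def)
  moreover have "0 < m v" if "0 \<le> v" "v \<noteq> 0" for v using g_pos[OF that] n by (simp add: m_def)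
  moreover have "\<exists>R. \<forall>v\<ge>0. R \<le> total v \<longrightarrow> c \<le> m v" for c
  proof (intro exI allI impI)
    fix v :: "real^'n" assume v: "0 \<le> v" "2 * n * c + n * B \<le> total v"
    have "total v - n * B = (\<Sum>i\<in>UNIV. v $ i - B)" by (simp add: sum_subtractf n_def)
    also have "\<dots> \<le> g v"
      unfolding g_def using bound[OF v(1)] by (intro sum_mono) (smt (verit))
    finally have "c * (2 * n) \<le> g v" using v(2) by (simp add: mult_ac)
    then show "c \<le> m v" using n by (simp add: m_def pos_le_divide_eq)
  qed
  ultimately obtain \<phi> :: "real \<Rightarrow> real" where \<phi>: "continuous_on UNIV \<phi>" "mono \<phi>" "\<And>r. 0 < r \<Longrightarrow> 0 < \<phi> r"
    "\<And>B. \<exists>r>0. B < \<phi> r" "\<And>v. 0 \<le> v \<Longrightarrow> \<phi> (total v) \<le> m v"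
    by (rule lower_modulus_total) blast+
  show ?thesis
  proof (rule Omega_path_of_raised_map[OF cont mono nonneg \<phi>(1-4)])
    fix s assume s: "0 \<le> s" "s \<noteq> 0" "\<And>i. s $ i \<le> max (T s $ i) (\<phi> (total s))"
    have m_pos: "0 < m s" using g_pos s n by (simp add: m_def)
    have "max 0 (s $ i - T s $ i) < 2 * m s" for i
    proof -
      have "s $ i - T s $ i \<le> m s"
      proof (cases "s $ i \<le> T s $ i")
        case True
        then show ?thesis using m_pos by simp
      next
        case False
        then have "s $ i \<le> m s" using s(3)[of i] \<phi>(5)[OF s(1)] by simp
        moreover have "0 \<le> T s $ i" using nonneg[OF s(1)] by (simp add: less_eq_vec_def)
        ultimately show ?thesis by simp
      qed
      then show ?thesis using m_pos by simp
    qed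
    then have "g s < (\<Sum>i\<in>(UNIV :: 'n set). 2 * m s)"
      unfolding g_def by (intro sum_strict_mono) auto
    also have "\<dots> = g s" using n by (simp add: m_def n_def)
    finally show False by simp
  qed auto
qed

section \<open>Maps whose iterates reach every component\<close>

lemma continuous_on_Min_image:
  fixes f :: "'a \<Rightarrow> 'b::topological_space \<Rightarrow> real"
  assumes "finite I" "I \<noteq> {}" "\<And>i. i \<in> I \<Longrightarrow> continuous_on S (f i)"
  shows "continuous_on S (\<lambda>x. Min ((\<lambda>i. f i x) ` I))"
  using assms
proof (induction I rule: finite_ne_induct)
  case (insert i I)
  then have "(\<lambda>x. Min ((\<lambda>i. f i x) ` insert i I)) = (\<lambda>x. min (f i x) (Min ((\<lambda>i. f i x) ` I)))"
    by auto
  then show ?case using insert by (auto intro!: continuous_intros)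
qed auto

text \<open>Keeping the maximum with \<open>s\<close> makes the iterates increase, so influences
  along paths of different lengths accumulate in one iterate.\<close>

definition sup_map :: "(real^'n \<Rightarrow> real^'n) \<Rightarrow> real^'n \<Rightarrow> real^'n" where
  "sup_map T s = (\<chi> i. max (s $ i) (T s $ i))"

lemma le_sup_map: "s \<le> sup_map T s"
  by (simp add: sup_map_def less_eq_vec_def)

lemma le_sup_map_iterate: "s \<le> (sup_map T ^^ k) s"
  by (induction k) (auto intro: order_trans[OF _ le_sup_map])

lemma Omega_path_eventually_positive:
  fixes T :: "real^'n::finite \<Rightarrow> real^'n"
  assumes cont: "continuous_on {0..} T"
    and mono: "\<And>x y. 0 \<le> x \<Longrightarrow> x \<le> y \<Longrightarrow> T x \<le> T y"
    and nonneg: "\<And>x. 0 \<le> x \<Longrightarrow> 0 \<le> T x"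
    and not_ge: "not_ge_id T"
    and pos: "\<And>v i. 0 \<le> v \<Longrightarrow> v \<noteq> 0 \<Longrightarrow> 0 < T ((sup_map T ^^ K) v) $ i"
    and large: "\<And>B i. \<exists>R. \<forall>v\<ge>0. R \<le> total v \<longrightarrow> B \<le> T ((sup_map T ^^ K) v) $ i"
  shows "\<exists>\<sigma>. Omega_path T \<sigma>"
proof -
  let ?S = "sup_map T"
  have iter_nonneg: "0 \<le> (?S ^^ k) v" if "0 \<le> v" for k v
    using le_sup_map_iterate that by (rule order_trans[rotated])
  have contS: "continuous_on {0..} ?S"
    unfolding sup_map_def by (intro continuous_on_vec_lambda continuous_intros cont)
  have cont_iter: "continuous_on {0..} (?S ^^ k)" for k
  proof (induction k)
    case 0
    then show ?case by (simp add: continuous_on_id)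
  next
    case (Suc k)
    then show ?case
      unfolding funpow.simps o_def
      by (rule continuous_on_compose2[OF contS]) (use iter_nonneg in auto)
  qed
  define m where "m v = Min (range (\<lambda>i. T ((?S ^^ K) v) $ i))" for v
  have m_le: "m v \<le> T ((?S ^^ K) v) $ i" for v i by (simp add: m_def)
  have contT: "continuous_on {0..} (\<lambda>v. T ((?S ^^ K) v))"
    by (rule continuous_on_compose2[OF cont cont_iter]) (use iter_nonneg in auto)
  have "continuous_on {0..} m"
    unfolding m_def by (rule continuous_on_Min_image) (auto intro!: continuous_intros contT)
  moreover have "0 \<le> m v" if "0 \<le> v" for v
    using nonneg[OF iter_nonneg[OF that]] by (simp add: m_def less_eq_vec_def)
  moreover have "0 < m v" if "0 \<le> v" "v \<noteq> 0" for v using pos[OF that] by (simp add: m_def)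
  moreover have "\<exists>R. \<forall>v\<ge>0. R \<le> total v \<longrightarrow> B \<le> m v" for B
  proof -
    obtain R where R: "\<And>i v. 0 \<le> v \<Longrightarrow> R i \<le> total v \<Longrightarrow> B \<le> T ((?S ^^ K) v) $ i"
      using large by metis
    have "B \<le> m v" if "0 \<le> v" "Max (range R) \<le> total v" for v
      using R[OF that(1)] that(2) by (simp add: m_def)
    then show ?thesis by blast
  qed
  ultimately obtain \<phi> :: "real \<Rightarrow> real" where \<phi>: "continuous_on UNIV \<phi>" "mono \<phi>" "\<And>r. 0 < r \<Longrightarrow> 0 < \<phi> r"
    "\<And>B. \<exists>r>0. B < \<phi> r" "\<And>v. 0 \<le> v \<Longrightarrow> \<phi> (total v) \<le> m v"
    by (rule lower_modulus_total) blast+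
  show ?thesis
  proof (rule Omega_path_of_raised_map[OF cont mono nonneg \<phi>(1-4)])
    fix s assume s: "0 \<le> s" "s \<noteq> 0" "\<And>i. s $ i \<le> max (T s $ i) (\<phi> (total s))"
    define u where "u = (?S ^^ K) s"
    have u_mono: "(?S ^^ k) s \<le> u" if "k \<le> K" for k
      unfolding u_def using that
      by (induction rule: inc_induct) (auto intro: order_trans[OF le_sup_map])
    \<comment> \<open>The bound \<phi> lies below every component of \<open>T u\<close>, and
      \<open>s \<le> u\<close> gives \<open>T s \<le> T u\<close>, which settles
      \<open>k = 0\<close>. Each further step adds only \<open>T\<close> of an iterate below
      \<open>u\<close>. At \<open>k = K\<close> this reads \<open>u \<le> T u\<close>.\<close>
    have "(?S ^^ k) s \<le> T u" if "k \<le> K" for k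
      using that
    proof (induction k)
      case 0
      have "\<phi> (total s) \<le> T u $ i" for i
        using \<phi>(5)[OF s(1)] m_le[of s i] by (simp add: u_def)
      moreover have "T s \<le> T u" using u_mono[of 0] s(1) by (intro mono) auto
      ultimately show ?case by (auto simp: less_eq_vec_def intro!: order_trans[OF s(3) max.boundedI])
    next
      case (Suc k)
      have "T ((?S ^^ k) s) \<le> T u"
        using u_mono[of k] Suc.prems iter_nonneg[OF s(1)] by (intro mono) auto
      then show ?case using Suc by (simp add: sup_map_def[of T "(?S ^^ k) s"] less_eq_vec_def)
    qed
    then have "u \<le> T u" by (simp add: u_def)
    moreover have "0 \<le> u" using iter_nonneg[OF s(1)] by (simp add: u_def)
    moreover have "u \<noteq> 0" using u_mono[of 0] s by (auto simp: order.antisym)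
    ultimately show False using not_ge by (auto simp: not_ge_id_def)
  qed auto
qed

section \<open>Gain operators\<close>

lemma class_K_mono: "g \<in> class_K \<Longrightarrow> 0 \<le> x \<Longrightarrow> x \<le> y \<Longrightarrow> g x \<le> g y"
  using strict_mono_onD[of "{0..}" g x y] by (cases "x = y") (simp_all add: class_K_def)

lemma class_K_pos: "g \<in> class_K \<Longrightarrow> 0 < x \<Longrightarrow> 0 < g x"
  using strict_mono_onD[of "{0..}" g 0 x] by (simp add: class_K_def)

lemma class_K_inf_large:
  assumes g: "g \<in> class_K_inf"
  shows "\<exists>R\<ge>0. \<forall>x\<ge>R. B \<le> g x"
proof -
  have gK: "g \<in> class_K" and unb: "\<not> bounded (g ` {0..})" using g by (auto simp: class_K_inf_def)
  have "0 \<le> g x" if "0 \<le> x" for x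
    using class_K_mono[OF gK, of 0 x] gK that by (simp add: class_K_def)
  then have "bounded (g ` {0..})" if "\<And>x. 0 \<le> x \<Longrightarrow> g x \<le> B"
    unfolding bounded_iff using that by (intro exI[of _ B]) auto
  then have "\<exists>x\<ge>0. B < g x" using unb not_le by blast
  then obtain R where "0 \<le> R" "B < g R" by blast
  then show ?thesis using class_K_mono[OF gK] by (intro exI[of _ R]) (auto intro: order_trans less_imp_le)
qed

text \<open>Strict monotonicity compares only vectors that differ in every component; raising all
  components of \<open>y\<close> slightly and passing to the limit yields the weak order.\<close>

lemma MAF_mono:
  fixes m :: "real^'n::finite \<Rightarrow> real"
  assumes m: "m \<in> MAF" and xy: "0 \<le> x" "x \<le> y"
  shows "m x \<le> m y"
proof -
  define z where "z k = (\<chi> i. y $ i + 1 / real (Suc k))" for k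
  have z: "0 \<le> z k" "strictly_below x (z k)" for k
  proof -
    have "0 \<le> x $ i" "x $ i \<le> y $ i" "0 < 1 / real (Suc k)" for i
      using xy by (simp_all add: less_eq_vec_def)
    then have "0 \<le> z k $ i" "x $ i < z k $ i" for i
      unfolding z_def vec_lambda_beta by (smt (verit))+
    then show "0 \<le> z k" "strictly_below x (z k)" by (simp_all add: less_eq_vec_def strictly_below_def)
  qed
  then have less: "m x \<le> m (z k)" for k
    using m xy by (auto simp: MAF_def less_imp_le)
  have "(\<lambda>k. z k $ i) \<longlonglongrightarrow> y $ i + 0" for i
    unfolding z_def vec_lambda_beta by (intro tendsto_intros LIMSEQ_Suc[OF lim_1_over_n])
  then have "z \<longlonglongrightarrow> y" by (intro vec_tendstoI) simp
  moreover have cont: "continuous_on {0..} m" and "y \<in> {0..}"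
    using m order_trans[OF xy] by (auto simp: MAF_def)
  ultimately have "(\<lambda>k. m (z k)) \<longlonglongrightarrow> m y"
    using continuous_on_tendsto_compose[OF cont, of z y sequentially] z(1) by simp
  then show ?thesis using less by (intro LIMSEQ_le_const) auto
qed

lemma MAF_large:
  assumes m: "m \<in> MAF"
  shows "\<exists>R. \<forall>x\<ge>0. R \<le> norm x \<longrightarrow> B \<le> m x"
proof -
  have "eventually (\<lambda>x. x \<in> {0..} \<longrightarrow> B \<le> m x) at_infinity"
    using m by (simp add: MAF_def filterlim_at_top eventually_inf_principal)
  then show ?thesis unfolding eventually_at_infinity by (meson atLeast_iff)
qed

locale gain_operator =
  fixes \<gamma> :: "'n::finite \<Rightarrow> 'n \<Rightarrow> real \<Rightarrow> real" and \<mu> :: "'n \<Rightarrow> real^'n \<Rightarrow> real"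
  assumes gains: "gain_matrix \<gamma>" and aggregation: "\<mu> i \<in> MAF"
begin

abbreviation T :: "real^'n \<Rightarrow> real^'n" where "T \<equiv> Gain_op \<gamma> \<mu>"

lemma gain_cases: "\<gamma> i j \<in> class_K \<or> \<gamma> i j \<in> zero_gain"
  using gains by (auto simp: gain_matrix_def)

lemma gain_0: "\<gamma> i j 0 = 0"
  using gain_cases[of i j] by (auto simp: class_K_def zero_gain_def)

lemma gain_mono: "0 \<le> x \<Longrightarrow> x \<le> y \<Longrightarrow> \<gamma> i j x \<le> \<gamma> i j y"
  using gain_cases[of i j] class_K_mono by (auto simp: zero_gain_def)

lemma gain_nonneg: "0 \<le> x \<Longrightarrow> 0 \<le> \<gamma> i j x"
  using gain_mono[of 0 x i j] by (simp add: gain_0)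

lemma gain_continuous: "continuous_on {0..} (\<gamma> i j)"
proof (cases "\<gamma> i j \<in> class_K")
  case False
  then have "continuous_on {0..} (\<gamma> i j) \<longleftrightarrow> continuous_on {0..} (\<lambda>x :: real. 0 :: real)"
    using gain_cases by (intro continuous_on_cong) (auto simp: zero_gain_def)
  then show ?thesis by simp
qed (simp add: class_K_def)

lemma gains_nonneg: "0 \<le> s \<Longrightarrow> 0 \<le> (\<chi> j. \<gamma> i j (s $ j))"
  by (simp add: less_eq_vec_def gain_nonneg)

lemma T_continuous: "continuous_on {0..} T"
proof -
  have "continuous_on {0..} (\<lambda>s. \<gamma> i j (s $ j))" for i j
    by (rule continuous_on_compose2[OF gain_continuous])
      (auto intro!: continuous_intros simp: less_eq_vec_def)
  then have inner: "continuous_on {0..} (\<lambda>s. \<chi> j. \<gamma> i j (s $ j))" for i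
    by (intro continuous_on_vec_lambda)
  have "continuous_on {0..} (\<mu> i)" for i using aggregation by (simp add: MAF_def)
  then have "continuous_on {0..} (\<lambda>s. \<mu> i (\<chi> j. \<gamma> i j (s $ j)))" for i
    by (rule continuous_on_compose2[OF _ inner]) (use gains_nonneg in auto)
  then show ?thesis unfolding Gain_op_def by (intro continuous_on_vec_lambda)
qed

lemma T_mono: "0 \<le> x \<Longrightarrow> x \<le> y \<Longrightarrow> T x \<le> T y"
  using MAF_mono[OF aggregation gains_nonneg] gain_mono by (simp add: Gain_op_def less_eq_vec_def)

lemma T_nonneg: "0 \<le> x \<Longrightarrow> 0 \<le> T x"
  using aggregation gains_nonneg by (simp add: Gain_op_def less_eq_vec_def MAF_def)

lemma Omega_path_bounded_gains:
  assumes bnd: "\<And>i j. \<gamma> i j \<in> (class_K - class_K_inf) \<union> zero_gain" and not_ge: "not_ge_id T"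
  shows "\<exists>\<sigma>. Omega_path T \<sigma>"
proof -
  have "\<exists>b. \<forall>x\<ge>0. \<gamma> i j x \<le> b" for i j
  proof (cases "\<gamma> i j \<in> zero_gain")
    case False
    then have "bounded (\<gamma> i j ` {0..})" using bnd[of i j] by (auto simp: class_K_inf_def)
    then show ?thesis unfolding bounded_iff by (auto intro: abs_le_D1)
  qed (auto simp: zero_gain_def)
  then obtain b where b: "\<And>i j x. 0 \<le> x \<Longrightarrow> \<gamma> i j x \<le> b i j" by metis
  define B where "B = (\<Sum>i\<in>UNIV. \<mu> i (\<chi> j. b i j))"
  have b_nonneg: "0 \<le> (\<chi> j. b i j)" for i
    using b[of 0] by (simp add: less_eq_vec_def gain_0)
  have "T x $ i \<le> B" if x: "0 \<le> x" for x i
  proof -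
    have "T x $ i \<le> \<mu> i (\<chi> j. b i j)"
      using MAF_mono[OF aggregation gains_nonneg[OF x]] b x by (simp add: Gain_op_def less_eq_vec_def)
    also have "\<dots> \<le> B"
      unfolding B_def using aggregation b_nonneg by (intro member_le_sum) (auto simp: MAF_def)
    finally show ?thesis .
  qed
  then show ?thesis
    using Omega_path_bounded[of T B] T_continuous T_mono T_nonneg not_ge by blast
qed

lemma T_pos:
  assumes "\<gamma> i l \<notin> zero_gain" "0 \<le> x" "0 < x $ l"
  shows "0 < T x $ i"
proof -
  have "0 < \<gamma> i l (x $ l)" using gain_cases assms(1,3) class_K_pos by blast
  then have "(\<chi> j. \<gamma> i j (x $ j)) \<noteq> 0" by (metis vec_lambda_beta zero_index less_irrefl)
  then show ?thesis
    using aggregation[of i] gains_nonneg[OF assms(2), of i] by (simp add: Gain_op_def MAF_def)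
qed

lemma T_large:
  assumes "\<gamma> i l \<in> class_K_inf"
  shows "\<exists>R. \<forall>x\<ge>0. R \<le> x $ l \<longrightarrow> B \<le> T x $ i"
proof -
  obtain R0 where R0: "\<And>y. 0 \<le> y \<Longrightarrow> R0 \<le> norm y \<Longrightarrow> B \<le> \<mu> i y"
    using MAF_large[OF aggregation] by blast
  obtain R where R: "\<And>t. R \<le> t \<Longrightarrow> R0 \<le> \<gamma> i l t" using class_K_inf_large[OF assms] by blast
  have "B \<le> T x $ i" if x: "0 \<le> x" "R \<le> x $ l" for x
  proof -
    have "R0 \<le> (\<chi> j. \<gamma> i j (x $ j)) $ l" using R[OF x(2)] by simp
    also have "\<dots> \<le> norm (\<chi> j. \<gamma> i j (x $ j))"
      using component_le_norm_cart by (rule abs_le_D1)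
    finally show ?thesis using R0[OF gains_nonneg[OF x(1)]] by (simp add: Gain_op_def)
  qed
  then show ?thesis by blast
qed

section \<open>Irreducible gain matrices\<close>

lemma adjacency_step:
  assumes "0 < mat_power (adjacency \<gamma>) (Suc k) $ i $ j"
  obtains l where "\<gamma> i l \<notin> zero_gain" "0 < mat_power (adjacency \<gamma>) k $ l $ j"
proof -
  have "(\<Sum>l\<in>UNIV. adjacency \<gamma> $ i $ l * mat_power (adjacency \<gamma>) k $ l $ j) \<noteq> 0"
    using assms by (simp add: matrix_matrix_mult_def del: sum_eq_0_iff)
  then obtain l where "adjacency \<gamma> $ i $ l * mat_power (adjacency \<gamma>) k $ l $ j \<noteq> 0"
    by (rule sum.not_neutral_contains_not_neutral)
  then show thesis using that[of l] by (auto simp: adjacency_def split: if_splits)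
qed

text \<open>A positive entry of the \<open>k\<close>-th power is a path of \<open>k\<close> nonzero
  gains from \<open>i\<close> to \<open>j\<close>; positivity and growth of component
  \<open>j\<close> travel along it, one gain per iteration.\<close>

lemma sup_map_iterate_path:
  assumes inf: "\<And>i j. \<gamma> i j \<in> class_K_inf \<union> zero_gain"
    and path: "0 < mat_power (adjacency \<gamma>) k $ i $ j"
  shows "(\<forall>v\<ge>0. 0 < v $ j \<longrightarrow> 0 < (sup_map T ^^ k) v $ i)
    \<and> (\<forall>B. \<exists>R. \<forall>v\<ge>0. R \<le> v $ j \<longrightarrow> B \<le> (sup_map T ^^ k) v $ i)"
  using path
proof (induction k arbitrary: i)
  case 0
  then have "i = j" by (simp add: mat_def split: if_splits)
  then show ?case by auto
next
  case (Suc k)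
  obtain l where l: "\<gamma> i l \<notin> zero_gain" "0 < mat_power (adjacency \<gamma>) k $ l $ j"
    using adjacency_step Suc.prems by blast
  have ge: "T ((sup_map T ^^ k) v) $ i \<le> (sup_map T ^^ Suc k) v $ i" for v
    by (simp add: sup_map_def[of T "(sup_map T ^^ k) v"])
  have nn: "0 \<le> (sup_map T ^^ k) v" if "0 \<le> v" for v
    using le_sup_map_iterate that by (rule order_trans[rotated])
  have "0 < (sup_map T ^^ Suc k) v $ i" if "0 \<le> v" "0 < v $ j" for v
    using T_pos[OF l(1) nn[OF that(1)]] Suc.IH[OF l(2)] that ge[of v] by (meson less_le_trans)
  moreover have "\<exists>R. \<forall>v\<ge>0. R \<le> v $ j \<longrightarrow> B \<le> (sup_map T ^^ Suc k) v $ i" for B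
  proof -
    obtain R1 where R1: "\<And>x. 0 \<le> x \<Longrightarrow> R1 \<le> x $ l \<Longrightarrow> B \<le> T x $ i"
      using T_large[of i l] inf[of i l] l(1) by blast
    obtain R where "\<And>v. 0 \<le> v \<Longrightarrow> R \<le> v $ j \<Longrightarrow> R1 \<le> (sup_map T ^^ k) v $ l"
      using Suc.IH[OF l(2)] by blast
    then show ?thesis using R1[OF nn] ge by (meson order_trans)
  qed
  ultimately show ?case by blast
qed

lemma Omega_path_irreducible:
  assumes inf: "\<And>i j. \<gamma> i j \<in> class_K_inf \<union> zero_gain"
    and irr: "irreducible_gain \<gamma>" and not_ge: "not_ge_id T"
  shows "\<exists>\<sigma>. Omega_path T \<sigma>"
proof -
  obtain k where k: "\<And>i j. 1 \<le> k i j" "\<And>i j. 0 < mat_power (adjacency \<gamma>) (k i j) $ i $ j"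
    using irr unfolding irreducible_gain_def by metis
  \<comment> \<open>A common bound for all path lengths; iterates of \<open>sup_map\<close>
    increase, so what a shorter path achieves persists.\<close>
  define K where "K = (\<Sum>i\<in>UNIV. \<Sum>j\<in>UNIV. k i j)"
  have k_le: "k i j \<le> K" for i j
  proof -
    have "k i j \<le> (\<Sum>j\<in>UNIV. k i j)" by (rule member_le_sum) auto
    also have "\<dots> \<le> K" unfolding K_def by (rule member_le_sum) auto
    finally show ?thesis .
  qed
  have iter: "(sup_map T ^^ k i j) v $ l \<le> (sup_map T ^^ K) v $ l" for i j v l
  proof -
    have "(sup_map T ^^ K) v = (sup_map T ^^ (K - k i j)) ((sup_map T ^^ k i j) v)"
      using k_le[of i j] funpow_add[of "K - k i j" "k i j" "sup_map T"] by simp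
    then show ?thesis using le_sup_map_iterate[of "(sup_map T ^^ k i j) v"] by (simp add: less_eq_vec_def)
  qed
  have nn: "0 \<le> (sup_map T ^^ K) v" if "0 \<le> v" for v
    using le_sup_map_iterate that by (rule order_trans[rotated])
  have "\<exists>l. \<gamma> i l \<notin> zero_gain" for i
  proof -
    \<comment> \<open>A closed path of length at least 1 through \<open>i\<close> has a first edge,
      so row \<open>i\<close> contains a nonzero gain.\<close>
    have "k i i = Suc (k i i - 1)" using k(1)[of i i] by simp
    then show ?thesis using adjacency_step k(2)[of i i] by metis
  qed
  then obtain l where l: "\<And>i. \<gamma> i (l i) \<notin> zero_gain" by metis
  show ?thesis
  proof (rule Omega_path_eventually_positive[OF T_continuous T_mono T_nonneg not_ge, where K = K])
    fix v :: "real^'n" and i assume v: "0 \<le> v" "v \<noteq> 0"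
    then obtain j where "0 < v $ j" by (auto simp: vec_eq_iff less_eq_vec_def order.strict_iff_order)
    then have "0 < (sup_map T ^^ k (l i) j) v $ l i"
      using sup_map_iterate_path[OF inf k(2)] v(1) by blast
    then have "0 < (sup_map T ^^ K) v $ l i" using iter less_le_trans by blast
    then show "0 < T ((sup_map T ^^ K) v) $ i" using T_pos[OF l nn[OF v(1)]] by blast
  next
    fix B i
    obtain R1 where R1: "\<And>x. 0 \<le> x \<Longrightarrow> R1 \<le> x $ l i \<Longrightarrow> B \<le> T x $ i"
      using T_large[of i "l i"] inf[of i "l i"] l by blast
    have "\<forall>j. \<exists>R. \<forall>v\<ge>0. R \<le> v $ j \<longrightarrow> R1 \<le> (sup_map T ^^ k (l i) j) v $ l i"
      using sup_map_iterate_path[OF inf k(2)] by blast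
    then obtain R where R: "\<And>j v. 0 \<le> v \<Longrightarrow> R j \<le> v $ j \<Longrightarrow> R1 \<le> (sup_map T ^^ k (l i) j) v $ l i"
      by metis
    have "B \<le> T ((sup_map T ^^ K) v) $ i" if v: "0 \<le> v" "(\<Sum>j\<in>UNIV. R j) \<le> total v" for v
    proof -
      \<comment> \<open>The threshold for the total is the sum of the thresholds for single
        components, so at least one of them is met.\<close>
      have "\<exists>j. R j \<le> v $ j"
      proof (rule ccontr)
        assume "\<nexists>j. R j \<le> v $ j"
        then have "total v < (\<Sum>j\<in>UNIV. R j)" by (intro sum_strict_mono) (auto simp: not_le)
        then show False using v(2) by simp
      qed
      then obtain j where "R j \<le> v $ j" ..
      then have "R1 \<le> (sup_map T ^^ K) v $ l i" using R[OF v(1)] iter order_trans by blast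
      then show ?thesis using R1[OF nn[OF v(1)]] by blast
    qed
    then show "\<exists>R. \<forall>v\<ge>0. R \<le> total v \<longrightarrow> B \<le> T ((sup_map T ^^ K) v) $ i" by blast
  qed
qed

section \<open>Gain operators of maximum type\<close>

text \<open>One strictly increasing function above the identity and all gains; its iterates serve as
  successive thresholds for component sizes.\<close>

definition gain_sum :: "real \<Rightarrow> real" where
  "gain_sum t = t + (\<Sum>i\<in>UNIV. \<Sum>j\<in>UNIV. \<gamma> i j t)"

lemma gain_sum_ge:
  assumes "0 \<le> t"
  shows "t \<le> gain_sum t" "\<gamma> i j t \<le> gain_sum t"
proof -
  have nn: "0 \<le> (\<Sum>j\<in>UNIV. \<gamma> i j t)" for i by (intro sum_nonneg gain_nonneg assms)
  then show "t \<le> gain_sum t" by (simp add: gain_sum_def sum_nonneg)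
  have "\<gamma> i j t \<le> (\<Sum>j\<in>UNIV. \<gamma> i j t)" by (rule member_le_sum) (auto intro: gain_nonneg assms)
  also have "\<dots> \<le> (\<Sum>i\<in>UNIV. \<Sum>j\<in>UNIV. \<gamma> i j t)" by (rule member_le_sum) (auto intro: nn)
  finally show "\<gamma> i j t \<le> gain_sum t" using assms by (simp add: gain_sum_def)
qed

lemma gain_sum_strict_mono: "0 \<le> x \<Longrightarrow> x < y \<Longrightarrow> gain_sum x < gain_sum y"
  unfolding gain_sum_def by (intro add_less_le_mono sum_mono gain_mono) auto

lemma gain_sum_iterate_ge: "0 \<le> t \<Longrightarrow> t \<le> (gain_sum ^^ k) t"
proof (induction k)
  case (Suc k)
  then show ?case using gain_sum_ge(1)[of "(gain_sum ^^ k) t"] by simp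
qed simp

lemma gain_sum_iterate_strict_mono: "0 \<le> x \<Longrightarrow> x < y \<Longrightarrow> (gain_sum ^^ k) x < (gain_sum ^^ k) y"
proof (induction k)
  case (Suc k)
  then show ?case
    using gain_sum_strict_mono gain_sum_iterate_ge[of x k] by simp
qed simp

lemma gain_sum_iterate_continuous: "continuous_on {0..} (gain_sum ^^ k)"
proof (induction k)
  case 0
  then show ?case by (simp add: continuous_on_id)
next
  case (Suc k)
  have "continuous_on {0..} gain_sum"
    unfolding gain_sum_def by (intro continuous_intros gain_continuous)
  from continuous_on_compose2[OF this Suc] show ?case
    unfolding funpow.simps o_def using gain_sum_iterate_ge by (force intro: order_trans)
qed

lemma gain_sum_iterate_0: "(gain_sum ^^ k) 0 = 0"
  by (induction k) (simp_all add: gain_sum_def gain_0)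

text \<open>With \<open>e = \<phi> (total s)\<close>, let \<open>J k\<close> collect the components
  above the \<open>k\<close>-th threshold \<open>(gain_sum ^^ k) e\<close>. These sets shrink
  strictly until empty, so \<open>J n\<close> is empty and all components are at most
  \<open>(gain_sum ^^ n) e\<close>. For \<phi> small enough this contradicts the size of
  \<open>total s\<close>.\<close>

lemma Omega_path_max:
  assumes max: "\<And>i s. 0 \<le> s \<Longrightarrow> \<mu> i s = Max (range (\<lambda>j. s $ j))" and not_ge: "not_ge_id T"
  shows "\<exists>\<sigma>. Omega_path T \<sigma>"
proof -
  define n where "n = CARD('n)"
  have n: "0 < n" by (simp add: n_def)
  \<comment> \<open>A set of \<open>n\<close> indices can shrink at most \<open>n\<close> times,
    hence \<open>n\<close> thresholds; the factor \<open>n\<close> sums the components.\<close>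
  define q where "q t = real n * (gain_sum ^^ n) t" for t
  have q_cont: "continuous_on {0..} q"
    unfolding q_def by (intro continuous_intros gain_sum_iterate_continuous)
  have q_mono: "q x < q y" if "0 \<le> x" "x < y" for x y
    using gain_sum_iterate_strict_mono[OF that] n by (simp add: q_def)
  have q_ge: "t \<le> q t" if "0 \<le> t" for t
  proof -
    have "1 * t \<le> real n * (gain_sum ^^ n) t"
      using gain_sum_iterate_ge[OF that, of n] that n by (intro mult_mono) auto
    then show ?thesis by (simp add: q_def)
  qed
  have q_0: "q 0 = 0" by (simp add: q_def gain_sum_iterate_0)
  have q_surj: "\<exists>t>0. q t = r" if r: "0 < r" for r
  proof -
    have "\<exists>t\<ge>0. t \<le> r \<and> q t = r"
      by (rule IVT') (use q_0 q_ge[of r] r continuous_on_subset[OF q_cont] in auto)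
    then obtain t where "0 \<le> t" "q t = r" by blast
    then show ?thesis using q_0 r by (intro exI[of _ t]) (cases "t = 0", auto)
  qed
  have pos: "\<exists>\<delta>>0. \<forall>t\<in>{0..}. R \<le> q t \<longrightarrow> \<delta> \<le> t / 2" if R: "0 < R" for R
  proof -
    obtain u where u: "0 < u" "q u = R" using q_surj[OF R] by blast
    have "u \<le> t" if "0 \<le> t" "R \<le> q t" for t using q_mono[of t u] that u by (meson not_le)
    then show ?thesis using u(1) by (intro exI[of _ "u/2"]) auto
  qed
  have large: "\<exists>R. \<forall>t\<in>{0..}. R \<le> q t \<longrightarrow> B \<le> t / 2" for B
  proof -
    have "B \<le> t / 2" if "0 \<le> t" "q (2 * \<bar>B\<bar>) \<le> q t" for t
      using q_mono[of t "2 * \<bar>B\<bar>"] that by (cases "t < 2 * \<bar>B\<bar>") auto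
    then show ?thesis by (intro exI[of _ "q (2 * \<bar>B\<bar>)"]) auto
  qed
  \<comment> \<open>Below the inverse of \<open>q\<close>, with the factor 1/2 making
    \<open>q (\<phi> r) < r\<close> strict.\<close>
  obtain \<phi> :: "real \<Rightarrow> real" where \<phi>: "continuous_on UNIV \<phi>" "mono \<phi>" "\<And>r. 0 < r \<Longrightarrow> 0 < \<phi> r"
    "\<And>B. \<exists>r>0. B < \<phi> r" "\<And>t. t \<in> {0..} \<Longrightarrow> \<phi> (q t) \<le> t / 2"
    by (rule lower_modulus[of "{0..}" "\<lambda>t. t / 2" q, OF _ _ pos large]) auto
  have q_\<phi>: "q (\<phi> r) < r" if r: "0 < r" for r
  proof -
    obtain t where t: "0 < t" "q t = r" using q_surj[OF r] by blast
    then have "\<phi> r < t" using \<phi>(5)[of t] by simp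
    then show ?thesis using q_mono[of "\<phi> r" t] \<phi>(3)[OF r] t by simp
  qed
  show ?thesis
  proof (rule Omega_path_of_raised_map[OF T_continuous T_mono T_nonneg \<phi>(1-4)])
    fix s assume s: "0 \<le> s" "s \<noteq> 0" "\<And>i. s $ i \<le> max (T s $ i) (\<phi> (total s))"
    define e where "e = \<phi> (total s)"
    have e: "0 < e" using \<phi>(3)[OF total_pos[OF s(1,2)]] by (simp add: e_def)
    define J where "J k = {i. (gain_sum ^^ k) e < s $ i}" for k
    have T_eq: "T v $ i = Max (range (\<lambda>j. \<gamma> i j (v $ j)))" if "0 \<le> v" for v i
      using max[OF gains_nonneg[OF that]] by (simp add: Gain_op_def)
    \<comment> \<open>A component above \<open>e\<close> must be bounded by \<open>T s\<close>
      itself, and the maximum is attained by a single gain.\<close>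
    have large_pred: "\<exists>j. s $ i \<le> \<gamma> i j (s $ j)" if "e < s $ i" for i
    proof -
      have "T s $ i \<in> range (\<lambda>j. \<gamma> i j (s $ j))" unfolding T_eq[OF s(1)] by (rule Max_in) auto
      moreover have "s $ i \<le> T s $ i" using s(3)[of i] that by (auto simp: e_def)
      ultimately show ?thesis by auto
    qed
    have e_iter: "e \<le> (gain_sum ^^ k) e" for k using gain_sum_iterate_ge e by simp
    have J_mono: "J (Suc k) \<subseteq> J k" for k
      using gain_sum_ge(1)[of "(gain_sum ^^ k) e"] e_iter[of k] e by (auto simp: J_def)
    txt \<open>A nonempty set of large components that one further step does not shrink carries a
      subvector contradicting the small gain condition.\<close>
    have J_shrinks: "J (Suc k) \<noteq> J k" if "J k \<noteq> {}" for k
    proof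
      assume eq: "J (Suc k) = J k"
      define v where "v = (\<chi> i. if i \<in> J k then s $ i else 0)"
      have v: "0 \<le> v" using s(1) by (simp add: v_def less_eq_vec_def)
      have "v $ i \<le> T v $ i" for i
      proof (cases "i \<in> J k")
        case True
        then have i: "(gain_sum ^^ Suc k) e < s $ i" using eq by (auto simp: J_def)
        then have "e < s $ i" using e_iter[of "Suc k"] by linarith
        then obtain j where j: "s $ i \<le> \<gamma> i j (s $ j)" using large_pred by blast
        have sj: "0 \<le> s $ j" using s(1) by (simp add: less_eq_vec_def)
        \<comment> \<open>If \<open>s $ j\<close> were at most the \<open>k\<close>-th threshold,
          its gain would be at most the next one, which \<open>s $ i\<close> exceeds.\<close>
        have "j \<in> J k"
        proof (rule ccontr)
          assume "j \<notin> J k"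
          then have "s $ j \<le> (gain_sum ^^ k) e" by (simp add: J_def)
          then have "gain_sum (s $ j) \<le> gain_sum ((gain_sum ^^ k) e)"
            using gain_sum_strict_mono[OF sj] by (cases "s $ j = (gain_sum ^^ k) e") (auto simp: less_le)
          then show False using i j gain_sum_ge(2)[OF sj, of i j] by simp
        qed
        then have "v $ i \<le> \<gamma> i j (v $ j)" using True j by (simp add: v_def)
        also have "\<dots> \<le> T v $ i" unfolding T_eq[OF v] by (rule Max_ge) auto
        finally show ?thesis .
      next
        case False
        then show ?thesis using T_nonneg[OF v] by (simp add: v_def less_eq_vec_def)
      qed
      moreover have "v \<noteq> 0"
      proof -
        obtain i where "i \<in> J k" using \<open>J k \<noteq> {}\<close> by blast
        then have "0 < v $ i" using e e_iter[of k] by (simp add: v_def J_def)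
        then show ?thesis by auto
      qed
      ultimately show False using not_ge v unfolding not_ge_id_def by (metis less_eq_vec_def)
    qed
    have "card (J k) + k \<le> n \<or> J k = {}" for k
    proof (induction k)
      case 0
      then show ?case by (simp add: n_def card_mono)
    next
      case (Suc k)
      show ?case
      proof (cases "J k = {}")
        case True
        then show ?thesis using J_mono[of k] by simp
      next
        case False
        then have "J (Suc k) \<subset> J k" using J_mono J_shrinks by blast
        then have "card (J (Suc k)) < card (J k)" by (intro psubset_card_mono) auto
        then show ?thesis using Suc False by auto
      qed
    qed
    from this[of n] have "J n = {}" by simp
    then have "s $ i \<le> (gain_sum ^^ n) e" for i by (auto simp: J_def not_less)
    then have "total s \<le> real n * (gain_sum ^^ n) e"
      unfolding n_def by (intro sum_bounded_above)
    also have "\<dots> < total s" using q_\<phi>[OF total_pos[OF s(1,2)]] by (simp add: q_def e_def)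
    finally show False by simp
  qed
qed

end

section \<open>Linear gain operators\<close>

text \<open>The supremum of reals needs a bounded set: comparing sizes at the largest component of
  an eigenvector bounds every eigenvalue by the sum of the absolute entries.\<close>

lemma spectrum_le_spectral_radius:
  assumes "z \<in> complex_spectrum A"
  shows "cmod z \<le> spectral_radius A"
  unfolding spectral_radius_def
proof (rule cSUP_upper[OF assms])
  define B where "B = (\<Sum>i\<in>UNIV. \<Sum>j\<in>UNIV. \<bar>A $ i $ j\<bar>)"
  have "cmod z \<le> B" if z: "z \<in> complex_spectrum A" for z
  proof -
    obtain v where v: "v \<noteq> 0" "map_matrix complex_of_real A *v v = z *s v"
      using z by (auto simp: complex_spectrum_def)
    define M where "M = Max (range (\<lambda>i. cmod (v $ i)))"
    have M: "cmod (v $ i) \<le> M" for i by (simp add: M_def)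
    have "M \<in> range (\<lambda>i. cmod (v $ i))" unfolding M_def by (rule Max_in) auto
    then obtain i where i: "M = cmod (v $ i)" by blast
    have "0 < M"
    proof -
      obtain j where "v $ j \<noteq> 0" using v(1) by (auto simp: vec_eq_iff)
      then show ?thesis using M[of j] by (meson less_le_trans zero_less_norm_iff)
    qed
    have "cmod z * M = cmod ((map_matrix complex_of_real A *v v) $ i)"
      unfolding v(2) i by (simp add: norm_mult)
    also have "\<dots> = cmod (\<Sum>j\<in>UNIV. complex_of_real (A $ i $ j) * v $ j)"
      by (simp add: matrix_vector_mult_def map_matrix_def)
    also have "\<dots> \<le> (\<Sum>j\<in>UNIV. \<bar>A $ i $ j\<bar> * M)"
      by (intro sum_norm_le) (auto simp: norm_mult intro: mult_left_mono M)
    also have "\<dots> = (\<Sum>j\<in>UNIV. \<bar>A $ i $ j\<bar>) * M" by (simp add: sum_distrib_right)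
    also have "\<dots> \<le> B * M"
      unfolding B_def using \<open>0 < M\<close> by (intro mult_right_mono member_le_sum) (auto intro: sum_nonneg)
    finally show ?thesis using \<open>0 < M\<close> by simp
  qed
  then show "bdd_above (cmod ` complex_spectrum A)" by (intro bdd_aboveI[of _ B]) auto
qed

lemma eigenvalue_in_complex_spectrum:
  fixes A :: "real^'n::finite^'n"
  assumes "A *v s = l *\<^sub>R s" "s \<noteq> 0"
  shows "complex_of_real l \<in> complex_spectrum A"
proof -
  define v where "v = (\<chi> i. complex_of_real (s $ i))"
  have "(\<Sum>j\<in>UNIV. A $ i $ j * s $ j) = l * s $ i" for i
    using arg_cong[OF assms(1), of "\<lambda>x. x $ i"] by (simp add: matrix_vector_mult_def)
  then have "(\<Sum>j\<in>UNIV. complex_of_real (A $ i $ j) * complex_of_real (s $ j))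
      = complex_of_real l * complex_of_real (s $ i)" for i
    by (metis (no_types, lifting) of_real_mult of_real_sum sum.cong)
  then have "map_matrix complex_of_real A *v v = complex_of_real l *s v"
    by (simp add: vec_eq_iff matrix_vector_mult_def map_matrix_def v_def)
  moreover have "v \<noteq> 0" using assms(2) by (auto simp: v_def vec_eq_iff)
  ultimately show ?thesis by (auto simp: complex_spectrum_def)
qed

text \<open>Eigenvectors of the positive perturbations \<open>L + 1/(k+1)\<close> converge to an eigenvector of \<open>L\<close>,
  so one of them has an eigenvalue below one.\<close>

lemma linear_decay_vector:
  fixes L :: "real^'n::finite \<Rightarrow> real^'n"
  assumes lin: "linear L" and nonneg: "\<And>s. 0 \<le> s \<Longrightarrow> 0 \<le> L s" and rad: "spectral_radius (matrix L) < 1"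
  obtains w l where "strictly_below 0 w" "0 < l" "l < 1" "strictly_below (L w) (l *\<^sub>R w)"
proof -
  have contL: "continuous_on UNIV L" using lin by (rule linear_continuous_on[OF linear_conv_bounded_linear[THEN iffD1]])
  define \<epsilon> where "\<epsilon> k = 1 / real (Suc k)" for k
  have \<epsilon>: "0 < \<epsilon> k" for k by (simp add: \<epsilon>_def)
  define u :: "real^'n" where "u = (\<chi> i. 1)"
  have ex: "\<exists>s l. 0 \<le> s \<and> total s = 1 \<and> 0 < l \<and> L s + \<epsilon> k *\<^sub>R u = l *\<^sub>R s" for k
  proof -
    have "continuous_on {0..} (\<lambda>s. L s + \<epsilon> k *\<^sub>R u)"
      by (intro continuous_intros continuous_on_subset[OF contL]) auto
    moreover have "0 < (L s + \<epsilon> k *\<^sub>R u) $ i" if "0 \<le> s" for s i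
      using nonneg[OF that] \<epsilon>[of k] by (simp add: u_def less_eq_vec_def add_nonneg_pos)
    ultimately show ?thesis using positive_map_eigenvector[of "\<lambda>s. L s + \<epsilon> k *\<^sub>R u" 1] by (metis zero_less_one)
  qed
  then obtain s l where s: "\<And>k. 0 \<le> s k" "\<And>k. total (s k) = 1" "\<And>k. 0 < l k"
    "\<And>k. L (s k) + \<epsilon> k *\<^sub>R u = l k *\<^sub>R s k" by metis
  have eq: "L (s k) $ i + \<epsilon> k = l k * s k $ i" for k i
    using arg_cong[OF s(4)[of k], of "\<lambda>x. x $ i"] by (simp add: u_def)
  have "\<exists>k. l k < 1"
  proof (rule ccontr)
    assume "\<nexists>k. l k < 1"
    then have l: "1 \<le> l k" for k by (auto simp: not_less)
    have "compact ({0..} \<inter> {s :: real^'n. 1 \<le> total s \<and> total s \<le> 1})"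
      by (rule compact_total_between) (simp_all add: closed_orthant)
    moreover have "\<forall>k. s k \<in> {0..} \<inter> {s. 1 \<le> total s \<and> total s \<le> 1}" using s by simp
    ultimately obtain t r where t: "t \<in> {0..} \<inter> {s :: real^'n. 1 \<le> total s \<and> total s \<le> 1}"
      and r: "strict_mono r" and lim: "(s \<circ> r) \<longlonglongrightarrow> t"
      using seq_compactE[OF compact_imp_seq_compact] by blast
    have Llim: "(\<lambda>k. L (s (r k))) \<longlonglongrightarrow> L t"
      using continuous_on_tendsto_compose[OF contL lim] by (simp add: o_def)
    have "\<epsilon> \<longlonglongrightarrow> 0" unfolding \<epsilon>_def by (rule LIMSEQ_Suc[OF lim_1_over_n])
    then have \<epsilon>lim: "(\<lambda>k. \<epsilon> (r k)) \<longlonglongrightarrow> 0" using LIMSEQ_subseq_LIMSEQ[OF _ r] by (simp add: o_def)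
    \<comment> \<open>Since the eigenvectors have total 1, the eigenvalue is read off from the total
      of the image, so it converges along with the eigenvectors.\<close>
    have l_eq: "l k = total (L (s k) + \<epsilon> k *\<^sub>R u)" for k
      unfolding s(4) using s(2)[of k] by (simp flip: sum_distrib_left)
    have sum_lim: "(\<lambda>k. L (s (r k)) + \<epsilon> (r k) *\<^sub>R u) \<longlonglongrightarrow> L t + 0 *\<^sub>R u"
      by (intro tendsto_intros Llim \<epsilon>lim)
    have "(\<lambda>k. total (L (s (r k)) + \<epsilon> (r k) *\<^sub>R u)) \<longlonglongrightarrow> total (L t + 0 *\<^sub>R u)"
      by (intro tendsto_sum tendsto_vec_nth sum_lim)
    then have l_lim: "(\<lambda>k. l (r k)) \<longlonglongrightarrow> total (L t)"
      by (simp only: l_eq[symmetric]) simp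
    have "(\<lambda>k. l (r k) *\<^sub>R s (r k)) \<longlonglongrightarrow> total (L t) *\<^sub>R t"
      using tendsto_scaleR[OF l_lim lim] by (simp add: o_def)
    moreover have "(\<lambda>k. l (r k) *\<^sub>R s (r k)) \<longlonglongrightarrow> L t" using sum_lim by (simp add: s(4))
    ultimately have "L t = total (L t) *\<^sub>R t" using LIMSEQ_unique by blast
    moreover have "t \<noteq> 0" using t by auto
    ultimately have "complex_of_real (total (L t)) \<in> complex_spectrum (matrix L)"
      using eigenvalue_in_complex_spectrum[of "matrix L" t] by (simp add: matrix_works linear_matrix_vector_mul_eq lin del: of_real_sum)
    then have "cmod (complex_of_real (total (L t))) \<le> spectral_radius (matrix L)"
      by (rule spectrum_le_spectral_radius)
    then have "\<bar>total (L t)\<bar> \<le> spectral_radius (matrix L)" by (simp only: norm_of_real)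
    moreover have "1 \<le> total (L t)" using l by (intro LIMSEQ_le_const[OF l_lim]) auto
    ultimately show False using rad by linarith
  qed
  then obtain k where k: "l k < 1" by blast
  have "0 < s k $ i" for i
  proof -
    have "0 < L (s k) $ i + \<epsilon> k" using nonneg[OF s(1)] \<epsilon>[of k] by (simp add: less_eq_vec_def add_nonneg_pos)
    then show ?thesis using eq[of k i] s(3)[of k] by (simp add: zero_less_mult_iff)
  qed
  moreover have "L (s k) $ i < l k * s k $ i" for i using eq[of k i] \<epsilon>[of k] by linarith
  ultimately show thesis using that[of "s k" "l k"] s(3) k by (simp add: strictly_below_def)
qed

lemma (in gain_operator) Omega_path_linear:
  assumes lin: "linear L" and eq: "\<And>s. 0 \<le> s \<Longrightarrow> T s = L s" and rad: "spectral_radius (matrix L) < 1"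
  shows "\<exists>\<sigma>. Omega_path T \<sigma>"
proof -
  have "0 \<le> L s" if "0 \<le> s" for s using T_nonneg[OF that] eq[OF that] by simp
  from linear_decay_vector[OF lin this rad]
  obtain v l where v: "strictly_below 0 v" and l: "0 < l" "l < 1" and Lv: "strictly_below (L v) (l *\<^sub>R v)"
    by blast
  have v_pos: "0 < v $ i" for i using v by (simp add: strictly_below_def)
  \<comment> \<open>One application of the linear map costs more than a factor \<open>l\<close>, so
    the ratio \<open>1 / l\<close> makes the image of \<open>w (m + 1)\<close> fall strictly below
    \<open>w m\<close>.\<close>
  define a where "a = 1 / l"
  have a: "1 < a" using l by (simp add: a_def)
  define w where "w m = (a powi m) *\<^sub>R v" for m
  have a_pow: "0 < a powi m" "a powi (m + 1) = a * a powi m" for m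
    using a by (auto simp: power_int_add)
  have "strictly_below 0 (w m)" for m using a_pow v_pos by (simp add: w_def strictly_below_def)
  moreover have "strictly_below (w m) (w (m + 1))" for m
    using a a_pow v_pos by (simp add: w_def strictly_below_def)
  moreover have "strictly_below (T (w (m + 1))) (w m)" for m
  proof -
    have "0 \<le> w (m + 1)" using a_pow(1) v_pos by (simp add: w_def less_eq_vec_def less_imp_le)
    then have "T (w (m + 1)) = (a powi (m + 1)) *\<^sub>R L v"
      by (simp add: eq w_def linear_scale[OF lin])
    moreover have "a powi (m + 1) * L v $ i < a powi (m + 1) * (l * v $ i)" for i
      using a_pow(1)[of "m + 1"] Lv by (simp add: strictly_below_def)
    moreover have "a powi (m + 1) * (l * v $ i) = a powi m * v $ i" for i
      unfolding a_pow(2) using l by (simp add: a_def)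
    ultimately show ?thesis by (simp add: w_def strictly_below_def)
  qed
  moreover have "\<exists>m. w m $ i < e" if e: "0 < e" for i e
  proof -
    obtain k where "l ^ k < e / v $ i"
      using real_arch_pow_inv[of "e / v $ i" l] e v_pos[of i] l by auto
    then have "w (- int k) $ i < e"
      using v_pos[of i] by (simp add: w_def a_def power_int_minus power_one_over field_simps)
    then show ?thesis by blast
  qed
  moreover have "\<exists>m. B < w m $ i" for i B
  proof -
    obtain k where "B / v $ i < a ^ k" using real_arch_pow[OF a] by blast
    then have "B < w (int k) $ i" using v_pos[of i] by (simp add: w_def field_simps)
    then show ?thesis by blast
  qed
  ultimately have "decay_chain T w" unfolding decay_chain_def by blast
  with T_mono show ?thesis by (rule decay_chain_imp_Omega_path)
qed

theorem theorem5p2: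
  fixes \<gamma> :: "'n::finite \<Rightarrow> 'n \<Rightarrow> real \<Rightarrow> real"
    and \<mu> :: "'n \<Rightarrow> real^'n \<Rightarrow> real"
  assumes "gain_matrix \<gamma>"
    and "\<forall>i. \<mu> i \<in> MAF"
    and "compatible \<gamma> \<mu>"
    and "((\<forall>i j. \<gamma> i j \<in> class_K_inf \<union> zero_gain)
            \<and> (\<exists>L. linear L \<and> (\<forall>s\<ge>0. Gain_op \<gamma> \<mu> s = L s) \<and> spectral_radius (matrix L) < 1))
       \<or> ((\<forall>i j. \<gamma> i j \<in> class_K_inf \<union> zero_gain)
            \<and> irreducible_gain \<gamma> \<and> not_ge_id (Gain_op \<gamma> \<mu>))
       \<or> ((\<forall>i j. \<gamma> i j \<in> class_K_inf \<union> zero_gain)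
            \<and> (\<forall>i. \<forall>s\<ge>0. \<mu> i s = Max (range (\<lambda>j. s $ j))) \<and> not_ge_id (Gain_op \<gamma> \<mu>))
       \<or> ((\<forall>i j. \<gamma> i j \<in> (class_K - class_K_inf) \<union> zero_gain)
            \<and> not_ge_id (Gain_op \<gamma> \<mu>))"
  shows "\<exists>\<sigma>. Omega_path (Gain_op \<gamma> \<mu>) \<sigma>"
proof -
  interpret gain_operator \<gamma> \<mu>
    using assms(1,2) by unfold_locales auto
  show ?thesis
    using assms(4)
  proof (elim disjE conjE exE)
    fix L assume "linear L" "\<forall>s\<ge>0. T s = L s" "spectral_radius (matrix L) < 1"
    then show ?thesis using Omega_path_linear by blast
  next
    assume "\<forall>i j. \<gamma> i j \<in> class_K_inf \<union> zero_gain" "irreducible_gain \<gamma>" "not_ge_id T"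
    then show ?thesis using Omega_path_irreducible by blast
  next
    assume "\<forall>i. \<forall>s\<ge>0. \<mu> i s = Max (range (\<lambda>j. s $ j))" "not_ge_id T"
    then show ?thesis using Omega_path_max by blast
  next
    assume "\<forall>i j. \<gamma> i j \<in> (class_K - class_K_inf) \<union> zero_gain" "not_ge_id T"
    then show ?thesis using Omega_path_bounded_gains by blast
  qed
qed

end
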